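(* Let $\Gamma$ be a countable group with two measure preserving actions $\Gamma\curvearrowright(X,\mu_X)$ and $\Gamma\curvearrowright(Y,\mu_Y)$ on standard Borel probability spaces. Put $\mathcal{G}=\Gamma\ltimes X$ and $\mathcal{H}=\Gamma\ltimes Y$. Suppose $Y$ is a factor of $X$, with factor map $T:X\to Y$, and let $f_T:\mathcal{G}\to\mathcal{H}$, $f_T(\gamma,x)=(\gamma,T(x))$. Then for every separable Hilbert coefficient $\mathcal{H}$-module $E$ the map $$\mathrm{H}^2_{mb}(f_T):\mathrm{H}^2_{mb}(\mathcal{H},E)\to\mathrm{H}^2_{mb}(\mathcal{G},E)$$ is injective, where $E$ is regarded as a $\mathcal{G}$-module by pullback along $f_T$.
   Context: **Factor.** $Y$ is a factor of $X$ if there is a Borel $\Gamma$-equivariant map $T:X\to Y$ with $T_*\mu_X=\mu_Y$. **Semidirect groupoid.** $\Gamma\ltimes X$ is the groupoid with underlying set $\Gamma\times X$, unit space $X$, $s(\gamma,x)=x$, $t(\gamma,x)=\gamma x$, $(\gamma',\gamma x)(\gamma,x)=(\gamma'\gamma,x)$, $(\gamma,x)^{-1}=(\gamma^{-1},\gamma x)$, and measure class of (counting)$\times\mu_X$. **Coefficients.** A measurable coefficient $\mathcal{H}$-module $(E,L)$: $E=(E^\flat)^*$ with $E^\flat$ separable Banach, with $L^\flat:\mathcal{H}\to\mathrm{Isom}(E^\flat)$ such that $L^\flat(gh)=L^\flat(g)L^\flat(h)$ for almost every composable pair and $g\mapsto L^\flat(g)v$ measurable for every $v$; $L$ is the contragredient,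 $\langle L(g)\lambda,v\rangle=\langle\lambda,L^\flat(g^{-1})v\rangle$. It is a separable Hilbert coefficient module if $E$ is a separable Hilbert space. Pullback along $f_T$: the $\mathcal{G}$-action $g\mapsto L(f_T(g))$. **Measurable bounded cohomology.** For the semidirect groupoid $\mathcal{G}=\Gamma\ltimes X$ with the measure class of (counting)$\times\mu_X$ and a measurable coefficient $\mathcal{G}$-module $(E,L)$ (and in the same way for $\mathcal{H}=\Gamma\ltimes Y$ with the measure class of (counting)$\times\mu_Y$ and a measurable coefficient $\mathcal{H}$-module), let $\nu$ be a symmetric probability measure in its measure class with disintegration $\nu=\int\nu^x\,d\mu(x)$ along $t$ ($\mu=t_*\nu$). $\mathcal{G}^{(n)}$ is the set of $n$-tuples in $\mathcal{G}$ with common target, with measure $\nu^{(n)}=\int(\nu^x)^{\otimes n}d\mu(x)$. $L^\infty_{w^*}(\mathcal{G}^{(n)},E)$: weak$^*$ measurable essentially bounded functions modulo a.e. equality; $\lambda$ is $\mathcal{G}$-invariant if $L(g)\lambda(g^{-1}g_1,\dots,g^{-1}g_n)=\lambda(g_1,\dots,g_n)$ for $\nu^{(n+1)}$-a.e. $(g,g_1,\dots,g_n)\in\mathcal{G}^{(n+1)}$. $\mathrm{H}^k_{mb}(\mathcal{G},E)$ is the $k$-th cohomology of $\big(L^\infty_{w^*}(\mathcal{G}^{(k+1)},E)^{\mathcal{G}}\big)_{k\ge0}$ with the homogeneous coboundary $\delta\lambda(g_1,\dots,g_{k+2})=\sum_i(-1)^{i-1}\lambda(\dots,\widehat{g_i},\dots)$.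 The map $\mathrm{H}^k_{mb}(f_T)$ is induced by $\lambda\mapsto\big((g_1,\dots,g_{k+1})\mapsto\lambda(f_T(g_1),\dots,f_T(g_{k+1}))\big)$. *)

theory Defs
  imports "HOL-Probability.Probability" "HOL-Algebra.Group_Action"
begin

section \<open>Standard Borel spaces, probability measure preserving actions and factors\<close>

definition standard_borel :: "'x measure \<Rightarrow> bool" where
  "standard_borel M \<longleftrightarrow>
     (\<exists>T. completely_metrizable_space T \<and> separable_space T \<and> topspace T = space M \<and>
          sets M = sigma_sets (topspace T) {U. openin T U})"

definition standard_probability_space :: "'x measure \<Rightarrow> bool" where
  "standard_probability_space M \<longleftrightarrow> standard_borel M \<and> prob_space M"

text \<open>The library's \<^const>\<open>group_action\<close> asks in addition that every \<open>act \<gamma>\<close> is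
  \<^const>\<open>undefined\<close> outside the space acted upon; this is only a normalization.\<close>

definition pmp_action :: "'g monoid \<Rightarrow> 'x measure \<Rightarrow> ('g \<Rightarrow> 'x \<Rightarrow> 'x) \<Rightarrow> bool" where
  "pmp_action \<Gamma> M act \<longleftrightarrow>
     group_action \<Gamma> (space M) act \<and>
     (\<forall>\<gamma>\<in>carrier \<Gamma>. act \<gamma> \<in> M \<rightarrow>\<^sub>M M \<and> distr M M (act \<gamma>) = M)"

definition factor_map ::
  "'g monoid \<Rightarrow> 'x measure \<Rightarrow> ('g \<Rightarrow> 'x \<Rightarrow> 'x) \<Rightarrow> 'y measure \<Rightarrow> ('g \<Rightarrow> 'y \<Rightarrow> 'y) \<Rightarrow> ('x \<Rightarrow> 'y) \<Rightarrow> bool"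
  where
  "factor_map \<Gamma> M actM N actN T \<longleftrightarrow>
     T \<in> M \<rightarrow>\<^sub>M N \<and>
     (\<forall>\<gamma>\<in>carrier \<Gamma>. \<forall>x\<in>space M. T (actM \<gamma> x) = actN \<gamma> (T x)) \<and>
     distr M N T = N"


section \<open>Measured groupoids\<close>

text \<open>The measure on \<open>arrows\<close> only matters through its measure class, the one on
  \<open>base\<close> only through its \<open>\<sigma>\<close>-algebra. The product \<open>gmult G g h\<close> is meaningful
  when \<open>source G g = target G h\<close>.\<close>

record ('a, 'x) measured_groupoid =
  arrows :: "'a measure"
  base :: "'x measure"
  source :: "'a \<Rightarrow> 'x"
  target :: "'a \<Rightarrow> 'x"
  gmult :: "'a \<Rightarrow> 'a \<Rightarrow> 'a"
  ginv :: "'a \<Rightarrow> 'a"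

definition semidirect ::
  "'g monoid \<Rightarrow> 'x measure \<Rightarrow> ('g \<Rightarrow> 'x \<Rightarrow> 'x) \<Rightarrow> ('g \<times> 'x, 'x) measured_groupoid" where
  "semidirect \<Gamma> M act =
     \<lparr>arrows = count_space (carrier \<Gamma>) \<Otimes>\<^sub>M M,
      base = M,
      source = (\<lambda>(\<gamma>, x). x),
      target = (\<lambda>(\<gamma>, x). act \<gamma> x),
      gmult = (\<lambda>(\<gamma>', x') (\<gamma>, x). (\<gamma>' \<otimes>\<^bsub>\<Gamma>\<^esub> \<gamma>, x)),
      ginv = (\<lambda>(\<gamma>, x). (inv\<^bsub>\<Gamma>\<^esub> \<gamma>, act \<gamma> x))\<rparr>"

text \<open>\<open>\<kappa> x\<close> is the measure \<open>\<nu>\<^sup>x\<close> of the disintegration of \<open>\<nu>\<close> along the target map.\<close>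

definition symmetric_class_measure ::
  "('a, 'x) measured_groupoid \<Rightarrow> 'a measure \<Rightarrow> ('x \<Rightarrow> 'a measure) \<Rightarrow> bool" where
  "symmetric_class_measure G \<nu> \<kappa> \<longleftrightarrow>
     prob_space \<nu> \<and> sets \<nu> = sets (arrows G) \<and>
     absolutely_continuous (arrows G) \<nu> \<and> absolutely_continuous \<nu> (arrows G) \<and>
     distr \<nu> \<nu> (ginv G) = \<nu> \<and>
     \<kappa> \<in> base G \<rightarrow>\<^sub>M prob_algebra (arrows G) \<and>
     \<nu> = distr \<nu> (base G) (target G) \<bind> \<kappa> \<and>
     (AE x in distr \<nu> (base G) (target G). AE g in \<kappa> x. target G g = x)"

text \<open>Tuples are indexed by \<open>0, \<dots>, n - 1\<close>.\<close>

definition tuples :: "('a, 'x) measured_groupoid \<Rightarrow> nat \<Rightarrow> (nat \<Rightarrow> 'a) set" where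
  "tuples G n =
     {p \<in> {..<n} \<rightarrow>\<^sub>E space (arrows G). \<forall>i<n. \<forall>j<n. target G (p i) = target G (p j)}"

definition tuple_measure ::
  "('a, 'x) measured_groupoid \<Rightarrow> 'a measure \<Rightarrow> ('x \<Rightarrow> 'a measure) \<Rightarrow> nat \<Rightarrow> (nat \<Rightarrow> 'a) measure"
  where
  "tuple_measure G \<nu> \<kappa> n =
     restrict_space
       (distr \<nu> (base G) (target G) \<bind> (\<lambda>x. Pi\<^sub>M {..<n} (\<lambda>_. \<kappa> x)))
       (tuples G n)"


section \<open>Coefficient modules\<close>

text \<open>Coefficients are dual spaces \<^typ>\<open>'b \<Rightarrow>\<^sub>L real\<close> with \<^typ>\<open>'b\<close> the predual \<open>E\<^sup>\<flat>\<close>.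
  The separability of the predual is the constraint \<^class>\<open>second_countable_topology\<close>.

  Almost every composable pair: for a symmetric \<open>\<nu>\<close>, the map
  \<open>(g, h) \<mapsto> (g\<^sup>-\<^sup>1, h)\<close> identifies pairs with common target, with their measure
  \<open>\<nu>\<^sup>(\<^sup>2\<^sup>)\<close>, with composable pairs.\<close>

definition coefficient_module ::
  "('a, 'x) measured_groupoid \<Rightarrow> 'a measure \<Rightarrow> ('x \<Rightarrow> 'a measure) \<Rightarrow>
   ('a \<Rightarrow> 'b::{banach, second_countable_topology} \<Rightarrow>\<^sub>L 'b) \<Rightarrow> bool" where
  "coefficient_module G \<nu> \<kappa> Lflat \<longleftrightarrow>
     (\<forall>g\<in>space (arrows G).
        (\<forall>v. norm (blinfun_apply (Lflat g) v) = norm v) \<and> surj (blinfun_apply (Lflat g))) \<and>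
     (AE p in tuple_measure G \<nu> \<kappa> 2.
        Lflat (gmult G (ginv G (p 0)) (p 1)) = Lflat (ginv G (p 0)) o\<^sub>L Lflat (p 1)) \<and>
     (\<forall>v. (\<lambda>g. blinfun_apply (Lflat g) v) \<in> borel_measurable (arrows G))"

definition contragredient ::
  "('a, 'x) measured_groupoid \<Rightarrow> ('a \<Rightarrow> 'b::banach \<Rightarrow>\<^sub>L 'b) \<Rightarrow>
   'a \<Rightarrow> ('b \<Rightarrow>\<^sub>L real) \<Rightarrow> ('b \<Rightarrow>\<^sub>L real)" where
  "contragredient G Lflat g \<phi> = \<phi> o\<^sub>L Lflat (ginv G g)"

text \<open>The norm of the Banach space \<^typ>\<open>'e\<close> comes from an inner product. No instance of
  \<^class>\<open>real_inner\<close> is asked for, since \<^typ>\<open>'b \<Rightarrow>\<^sub>L real\<close> has none.\<close>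

definition separable_hilbert :: "'e::banach itself \<Rightarrow> bool" where
  "separable_hilbert _ \<longleftrightarrow>
     separable_space (euclidean :: 'e topology) \<and>
     (\<exists>ip :: 'e \<Rightarrow> 'e \<Rightarrow> real.
        bilinear ip \<and> (\<forall>x y. ip x y = ip y x) \<and> (\<forall>x. ip x x = (norm x)\<^sup>2))"

definition separable_hilbert_coefficient_module ::
  "('a, 'x) measured_groupoid \<Rightarrow> 'a measure \<Rightarrow> ('x \<Rightarrow> 'a measure) \<Rightarrow>
   ('a \<Rightarrow> 'b::{banach, second_countable_topology} \<Rightarrow>\<^sub>L 'b) \<Rightarrow> bool" where
  "separable_hilbert_coefficient_module G \<nu> \<kappa> Lflat \<longleftrightarrow>
     coefficient_module G \<nu> \<kappa> Lflat \<and> separable_hilbert TYPE('b \<Rightarrow>\<^sub>L real)"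


section \<open>Measurable bounded cohomology\<close>

definition bounded_weakstar_functions ::
  "('a, 'x) measured_groupoid \<Rightarrow> 'a measure \<Rightarrow> ('x \<Rightarrow> 'a measure) \<Rightarrow> nat \<Rightarrow>
   ((nat \<Rightarrow> 'a) \<Rightarrow> ('b::banach \<Rightarrow>\<^sub>L real)) monoid" where
  "bounded_weakstar_functions G \<nu> \<kappa> n =
     \<lparr>carrier =
        {\<phi>. (\<forall>v. (\<lambda>p. blinfun_apply (\<phi> p) v) \<in> borel_measurable (tuple_measure G \<nu> \<kappa> n)) \<and>
            (\<exists>C. AE p in tuple_measure G \<nu> \<kappa> n. norm (\<phi> p) \<le> C)},
      mult = (\<lambda>\<phi> \<psi> p. \<phi> p + \<psi> p),
      one = (\<lambda>_. 0)\<rparr>"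

definition null_functions ::
  "('a, 'x) measured_groupoid \<Rightarrow> 'a measure \<Rightarrow> ('x \<Rightarrow> 'a measure) \<Rightarrow> nat \<Rightarrow>
   ((nat \<Rightarrow> 'a) \<Rightarrow> ('b::banach \<Rightarrow>\<^sub>L real)) set" where
  "null_functions G \<nu> \<kappa> n =
     {\<phi> \<in> carrier (bounded_weakstar_functions G \<nu> \<kappa> n). AE p in tuple_measure G \<nu> \<kappa> n. \<phi> p = 0}"

definition Linfty ::
  "('a, 'x) measured_groupoid \<Rightarrow> 'a measure \<Rightarrow> ('x \<Rightarrow> 'a measure) \<Rightarrow> nat \<Rightarrow>
   ((nat \<Rightarrow> 'a) \<Rightarrow> ('b::banach \<Rightarrow>\<^sub>L real)) set monoid" where
  "Linfty G \<nu> \<kappa> n = bounded_weakstar_functions G \<nu> \<kappa> n Mod null_functions G \<nu> \<kappa> n"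

definition ae_class ::
  "('a, 'x) measured_groupoid \<Rightarrow> 'a measure \<Rightarrow> ('x \<Rightarrow> 'a measure) \<Rightarrow> nat \<Rightarrow>
   ((nat \<Rightarrow> 'a) \<Rightarrow> ('b::banach \<Rightarrow>\<^sub>L real)) \<Rightarrow> ((nat \<Rightarrow> 'a) \<Rightarrow> ('b \<Rightarrow>\<^sub>L real)) set" where
  "ae_class G \<nu> \<kappa> n \<phi> =
     null_functions G \<nu> \<kappa> n #>\<^bsub>bounded_weakstar_functions G \<nu> \<kappa> n\<^esub> \<phi>"

definition invariant_function ::
  "('a, 'x) measured_groupoid \<Rightarrow> 'a measure \<Rightarrow> ('x \<Rightarrow> 'a measure) \<Rightarrow>
   ('a \<Rightarrow> ('b::banach \<Rightarrow>\<^sub>L real) \<Rightarrow> ('b \<Rightarrow>\<^sub>L real)) \<Rightarrow> nat \<Rightarrow>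
   ((nat \<Rightarrow> 'a) \<Rightarrow> ('b \<Rightarrow>\<^sub>L real)) \<Rightarrow> bool" where
  "invariant_function G \<nu> \<kappa> L n \<phi> \<longleftrightarrow>
     (AE q in tuple_measure G \<nu> \<kappa> (Suc n).
        L (q 0) (\<phi> (\<lambda>i\<in>{..<n}. gmult G (ginv G (q 0)) (q (Suc i)))) =
        \<phi> (\<lambda>i\<in>{..<n}. q (Suc i)))"

definition cochains ::
  "('a, 'x) measured_groupoid \<Rightarrow> 'a measure \<Rightarrow> ('x \<Rightarrow> 'a measure) \<Rightarrow>
   ('a \<Rightarrow> ('b::banach \<Rightarrow>\<^sub>L real) \<Rightarrow> ('b \<Rightarrow>\<^sub>L real)) \<Rightarrow> nat \<Rightarrow>
   ((nat \<Rightarrow> 'a) \<Rightarrow> ('b \<Rightarrow>\<^sub>L real)) set set" where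
  "cochains G \<nu> \<kappa> L k =
     {A \<in> carrier (Linfty G \<nu> \<kappa> (Suc k)). \<forall>\<phi>\<in>A. invariant_function G \<nu> \<kappa> L (Suc k) \<phi>}"

definition omit :: "nat \<Rightarrow> nat \<Rightarrow> (nat \<Rightarrow> 'a) \<Rightarrow> (nat \<Rightarrow> 'a)" where
  "omit n i p = (\<lambda>j\<in>{..<n}. p (if j < i then j else Suc j))"

definition coboundary_function ::
  "nat \<Rightarrow> ((nat \<Rightarrow> 'a) \<Rightarrow> 'e::real_vector) \<Rightarrow> ((nat \<Rightarrow> 'a) \<Rightarrow> 'e)" where
  "coboundary_function k \<phi> p = (\<Sum>i<k + 2. (-1) ^ i *\<^sub>R \<phi> (omit (k + 1) i p))"

text \<open>Maps on quotients are written as unions over all representatives: the image classes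
  of equivalent representatives coincide, so that such a union is a single class.\<close>

definition coboundary ::
  "('a, 'x) measured_groupoid \<Rightarrow> 'a measure \<Rightarrow> ('x \<Rightarrow> 'a measure) \<Rightarrow> nat \<Rightarrow>
   ((nat \<Rightarrow> 'a) \<Rightarrow> ('b::banach \<Rightarrow>\<^sub>L real)) set \<Rightarrow> ((nat \<Rightarrow> 'a) \<Rightarrow> ('b \<Rightarrow>\<^sub>L real)) set" where
  "coboundary G \<nu> \<kappa> k A = (\<Union>\<phi>\<in>A. ae_class G \<nu> \<kappa> (k + 2) (coboundary_function k \<phi>))"

definition cocycles ::
  "('a, 'x) measured_groupoid \<Rightarrow> 'a measure \<Rightarrow> ('x \<Rightarrow> 'a measure) \<Rightarrow>
   ('a \<Rightarrow> ('b::banach \<Rightarrow>\<^sub>L real) \<Rightarrow> ('b \<Rightarrow>\<^sub>L real)) \<Rightarrow> nat \<Rightarrow>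
   ((nat \<Rightarrow> 'a) \<Rightarrow> ('b \<Rightarrow>\<^sub>L real)) set monoid" where
  "cocycles G \<nu> \<kappa> L k =
     (Linfty G \<nu> \<kappa> (k + 1))
       \<lparr>carrier := {A \<in> cochains G \<nu> \<kappa> L k. coboundary G \<nu> \<kappa> k A = \<one>\<^bsub>Linfty G \<nu> \<kappa> (k + 2)\<^esub>}\<rparr>"

definition coboundaries ::
  "('a, 'x) measured_groupoid \<Rightarrow> 'a measure \<Rightarrow> ('x \<Rightarrow> 'a measure) \<Rightarrow>
   ('a \<Rightarrow> ('b::banach \<Rightarrow>\<^sub>L real) \<Rightarrow> ('b \<Rightarrow>\<^sub>L real)) \<Rightarrow> nat \<Rightarrow>
   ((nat \<Rightarrow> 'a) \<Rightarrow> ('b \<Rightarrow>\<^sub>L real)) set set" where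
  "coboundaries G \<nu> \<kappa> L k =
     (case k of 0 \<Rightarrow> {\<one>\<^bsub>Linfty G \<nu> \<kappa> 1\<^esub>} | Suc m \<Rightarrow> coboundary G \<nu> \<kappa> m ` cochains G \<nu> \<kappa> L m)"

text \<open>Only the underlying additive group of the cohomology space is recorded.\<close>

definition Hmb ::
  "('a, 'x) measured_groupoid \<Rightarrow> 'a measure \<Rightarrow> ('x \<Rightarrow> 'a measure) \<Rightarrow>
   ('a \<Rightarrow> ('b::banach \<Rightarrow>\<^sub>L real) \<Rightarrow> ('b \<Rightarrow>\<^sub>L real)) \<Rightarrow> nat \<Rightarrow>
   ((nat \<Rightarrow> 'a) \<Rightarrow> ('b \<Rightarrow>\<^sub>L real)) set set monoid" where
  "Hmb G \<nu> \<kappa> L k = cocycles G \<nu> \<kappa> L k Mod coboundaries G \<nu> \<kappa> L k"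

definition pullback_function ::
  "('a \<Rightarrow> 'c) \<Rightarrow> nat \<Rightarrow> ((nat \<Rightarrow> 'c) \<Rightarrow> 'e) \<Rightarrow> ((nat \<Rightarrow> 'a) \<Rightarrow> 'e)" where
  "pullback_function f n \<phi> p = \<phi> (\<lambda>i\<in>{..<n}. f (p i))"

definition pullback ::
  "('a, 'x) measured_groupoid \<Rightarrow> 'a measure \<Rightarrow> ('x \<Rightarrow> 'a measure) \<Rightarrow> ('a \<Rightarrow> 'c) \<Rightarrow> nat \<Rightarrow>
   ((nat \<Rightarrow> 'c) \<Rightarrow> ('b::banach \<Rightarrow>\<^sub>L real)) set \<Rightarrow> ((nat \<Rightarrow> 'a) \<Rightarrow> ('b \<Rightarrow>\<^sub>L real)) set" where
  "pullback G \<nu> \<kappa> f n A = (\<Union>\<phi>\<in>A. ae_class G \<nu> \<kappa> n (pullback_function f n \<phi>))"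

text \<open>The map induced by \<open>f\<close> on cohomology in degree \<open>k\<close>. The groupoid \<open>G\<close> is the
  domain of \<open>f\<close>, and \<open>L\<close> the action of its codomain on the coefficients.\<close>

definition Hmb_map ::
  "('a, 'x) measured_groupoid \<Rightarrow> 'a measure \<Rightarrow> ('x \<Rightarrow> 'a measure) \<Rightarrow> ('a \<Rightarrow> 'c) \<Rightarrow>
   ('c \<Rightarrow> ('b::banach \<Rightarrow>\<^sub>L real) \<Rightarrow> ('b \<Rightarrow>\<^sub>L real)) \<Rightarrow> nat \<Rightarrow>
   ((nat \<Rightarrow> 'c) \<Rightarrow> ('b \<Rightarrow>\<^sub>L real)) set set \<Rightarrow> ((nat \<Rightarrow> 'a) \<Rightarrow> ('b \<Rightarrow>\<^sub>L real)) set set" where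
  "Hmb_map G \<nu> \<kappa> f L k C =
     (\<Union>A\<in>C. coboundaries G \<nu> \<kappa> (\<lambda>g. L (f g)) k
              #>\<^bsub>cocycles G \<nu> \<kappa> (\<lambda>g. L (f g)) k\<^esub> pullback G \<nu> \<kappa> f (k + 1) A)"

definition semidirect_map :: "('x \<Rightarrow> 'y) \<Rightarrow> 'g \<times> 'x \<Rightarrow> 'g \<times> 'y" where
  "semidirect_map T = (\<lambda>(\<gamma>, x). (\<gamma>, T x))"

end

theory Submission
  imports Defs
begin

text \<open>
  A tuple of arrows of \<open>\<Gamma> \<ltimes> X\<close> with common target \<open>x\<close> is the same as a tuple \<open>g\<close> in \<open>\<Gamma>\<close>
  together with \<open>x\<close>, and the measure class of the tuples is that of (counting)\<open>\<times>\<mu>\<^sub>X\<close>. So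
  cochains are families, indexed by the tuples \<open>g\<close>, of bounded weak* measurable functions
  on \<open>X\<close>. Weak* conditional expectation along \<open>T\<close>, applied to each member of such a family, maps
  invariant cochains on \<open>X\<close> to invariant cochains on \<open>Y\<close>, because \<open>L\<close> is pulled back from \<open>Y\<close>
  and \<open>\<Gamma>\<close> preserves the measures. It commutes with the coboundary and is a left inverse
  of the pullback, so it turns a primitive of a pulled back cocycle into a primitive of the cocycle.
\<close>

section \<open>Measurability and additive functions\<close>

text \<open>Two obstacles shape the development. The measure on tuples is built from the fibre
  measures \<open>\<nu>\<^sup>x\<close>, which are given only through the disintegration of some
  symmetric measure in the class. Reading cochains as families indexed by group tuples requires that
  almost every fibre measure charges every arrow into its base point; this is extracted from the
  null sets of \<open>\<nu>\<close> and the disintegration. The second obstacle is that averaging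
  along \<open>T\<close> is a scalar operation: it yields one function on \<open>Y\<close> for each
  vector of the predual, each up to a null set of its own, while a cochain needs one functional at
  each point. Separability reduces the compatibility conditions to countably many vectors, where one
  null set is enough. Averaging does not increase the bound, and one constant serves all group
  tuples, so the descended primitive is again essentially bounded.\<close>

lemma standard_borel_countably_separated:
  assumes "standard_borel M"
  obtains \<U> where "countable \<U>" "\<U> \<subseteq> sets M"
    "\<And>x y. x \<in> space M \<Longrightarrow> y \<in> space M \<Longrightarrow> (\<And>U. U \<in> \<U> \<Longrightarrow> x \<in> U \<longleftrightarrow> y \<in> U) \<Longrightarrow> x = y"
proof -
  from assms obtain T where T: "completely_metrizable_space T" "separable_space T" "topspace T = space M"
      "sets M = sigma_sets (topspace T) {U. openin T U}"
    unfolding standard_borel_def by blast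
  from T(1) obtain S d where Md: "Metric_space S d" "T = Metric_space.mtopology S d"
    unfolding completely_metrizable_space_def by auto
  interpret Metric_space S d by (rule Md(1))
  have S: "S = space M" using T(3) Md(2) by simp
  from T(2) obtain C where C: "countable C" "C \<subseteq> S" "T closure_of C = S"
    unfolding separable_space_def using Md(2) by auto
  \<comment> \<open>Once twice the radius \<open>1 / Suc n\<close> is below \<open>d x y\<close>, a
    ball of that radius that contains \<open>x\<close> cannot contain \<open>y\<close> as
    well.\<close>
  define \<U> where "\<U> = (\<lambda>(c, n::nat). mball c (1 / Suc n)) ` (C \<times> UNIV)"
  show thesis
  proof (rule that)
    show "countable \<U>" unfolding \<U>_def using C(1) by auto
    show "\<U> \<subseteq> sets M" unfolding \<U>_def T(4) Md(2) by (auto intro!: sigma_sets.Basic)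
    fix x y assume xy: "x \<in> space M" "y \<in> space M"
      and sep: "\<And>U. U \<in> \<U> \<Longrightarrow> x \<in> U \<longleftrightarrow> y \<in> U"
    show "x = y"
    proof (rule ccontr)
      assume ne: "x \<noteq> y"
      with xy S have "d x y > 0" by simp
      then obtain n where n: "1 / Suc n < d x y / 2"
        using nat_approx_posE[of "d x y / 2"] by (metis half_gt_zero)
      have "x \<in> mtopology closure_of C" using xy(1) S C(3) Md(2) by simp
      then have "\<forall>r>0. \<exists>c\<in>C. c \<in> mball x r"
        unfolding metric_closure_of by blast
      moreover have "1 / Suc n > 0" by simp
      ultimately obtain c where c: "c \<in> C" "c \<in> mball x (1 / Suc n)" by blast
      have "x \<in> mball c (1 / Suc n)" using c C(2) by (auto simp: commute)
      moreover have "mball c (1 / Suc n) \<in> \<U>" using c unfolding \<U>_def by auto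
      ultimately have "y \<in> mball c (1 / Suc n)" "x \<in> mball c (1 / Suc n)" using sep by blast+
      then have "d x y < 1 / Suc n + 1 / Suc n"
        using triangle[of x c y] by (auto simp: commute)
      then show False using n by linarith
    qed
  qed
qed

text \<open>Countably many measurable sets separate points, so equality is a countable conjunction
  of membership conditions. This makes measurable the condition that the arrows of a tuple share one
  target.\<close>

lemma standard_borel_measurable_eq:
  assumes "standard_borel M" and f[measurable]: "f \<in> N \<rightarrow>\<^sub>M M" and g[measurable]: "g \<in> N \<rightarrow>\<^sub>M M"
  shows "Measurable.pred N (\<lambda>z. f z = g z)"
proof -
  obtain \<U> where \<U>: "countable \<U>" "\<U> \<subseteq> sets M"
    "\<And>x y. x \<in> space M \<Longrightarrow> y \<in> space M \<Longrightarrow> (\<And>U. U \<in> \<U> \<Longrightarrow> x \<in> U \<longleftrightarrow> y \<in> U) \<Longrightarrow> x = y"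
    using standard_borel_countably_separated[OF assms(1)] by metis
  \<comment> \<open>\<open>from_nat_into\<close> enumerates a nonempty countable set; the added
    \<open>{}\<close> ensures this and separates nothing.\<close>
  define U where "U = from_nat_into (insert {} \<U>)"
  have rU: "range U = insert {} \<U>" unfolding U_def using \<U>(1) by (intro range_from_nat_into) auto
  then have [measurable]: "U n \<in> sets M" for n using \<U>(2) by (metis insert_subset rangeI sets.empty_sets subsetD)
  have "Measurable.pred N (\<lambda>z. \<forall>n. f z \<in> U n \<longleftrightarrow> g z \<in> U n)" by measurable
  moreover have "(\<forall>n. f z \<in> U n \<longleftrightarrow> g z \<in> U n) \<longleftrightarrow> f z = g z" if z: "z \<in> space N" for z
  proof
    assume h: "\<forall>n. f z \<in> U n \<longleftrightarrow> g z \<in> U n"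
    show "f z = g z"
    proof (rule \<U>(3)[OF measurable_space[OF f z] measurable_space[OF g z]])
      fix V assume "V \<in> \<U>"
      then obtain n where "V = U n" using rU by (metis insertCI rangeE)
      then show "f z \<in> V \<longleftrightarrow> g z \<in> V" using h by simp
    qed
  qed simp
  ultimately show ?thesis by (simp cong: measurable_cong)
qed

lemma emeasure_PiM_prob_space:
  assumes "finite I" "prob_space N" "\<And>i. i \<in> I \<Longrightarrow> B i \<in> sets N"
  shows "emeasure (Pi\<^sub>M I (\<lambda>_. N)) (Pi\<^sub>E I B) = (\<Prod>i\<in>I. emeasure N (B i))"
proof -
  interpret prob_space N by (rule assms)
  interpret product_sigma_finite "\<lambda>_. N" by standard
  show ?thesis using assms by (intro emeasure_PiM) auto
qed

text \<open>It is enough to measure boxes, whose mass is a finite product of the measurable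
  functions \<open>emeasure (\<kappa> x) (B i)\<close>. The powers of the fibre measures thus form a
  kernel, and the bind in \<open>tuple_measure\<close> can be evaluated.\<close>

lemma measurable_PiM_prob_algebra:
  assumes "finite I" and \<kappa>: "\<kappa> \<in> M \<rightarrow>\<^sub>M prob_algebra N"
  shows "(\<lambda>x. Pi\<^sub>M I (\<lambda>_. \<kappa> x)) \<in> M \<rightarrow>\<^sub>M prob_algebra (Pi\<^sub>M I (\<lambda>_. N))"
proof (rule measurable_prob_algebra_generated[OF sets_PiM Int_stable_prod_algebra prod_algebra_sets_into_space])
  have k: "prob_space (\<kappa> x)" "sets (\<kappa> x) = sets N" if "x \<in> space M" for x
    using measurable_space[OF \<kappa> that] by (auto simp: space_prob_algebra)
  fix x assume x: "x \<in> space M"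
  show "prob_space (Pi\<^sub>M I (\<lambda>_. \<kappa> x))" by (intro prob_space_PiM k x)
  show "sets (Pi\<^sub>M I (\<lambda>_. \<kappa> x)) = sets (Pi\<^sub>M I (\<lambda>_. N))"
    using k(2)[OF x] by (intro sets_PiM_cong) auto
next
  have k: "prob_space (\<kappa> x)" "sets (\<kappa> x) = sets N" if "x \<in> space M" for x
    using measurable_space[OF \<kappa> that] by (auto simp: space_prob_algebra)
  fix A assume "A \<in> prod_algebra I (\<lambda>_. N)"
  then obtain B where B: "A = Pi\<^sub>E I B" "\<And>i. i \<in> I \<Longrightarrow> B i \<in> sets N"
    using assms(1) by (auto simp: prod_algebra_eq_finite Pi_iff)
  have "(\<lambda>x. \<Prod>i\<in>I. emeasure (\<kappa> x) (B i)) \<in> borel_measurable M"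
    using B(2) measurable_prob_algebraD[OF \<kappa>]
    by (intro borel_measurable_prod_ennreal measurable_emeasure_kernel) auto
  moreover have "emeasure (Pi\<^sub>M I (\<lambda>_. \<kappa> x)) A = (\<Prod>i\<in>I. emeasure (\<kappa> x) (B i))" if "x \<in> space M" for x
    unfolding B(1) using B(2) k[OF that] assms(1) by (intro emeasure_PiM_prob_space) auto
  ultimately show "(\<lambda>x. emeasure (Pi\<^sub>M I (\<lambda>_. \<kappa> x)) A) \<in> borel_measurable M"
    by (simp cong: measurable_cong)
qed

text \<open>Additivity gives homogeneity over the integers. This recovers real linearity for
  functionals that are constructed from a group of vectors, without scalars.\<close>

lemma bounded_additive_scaleR:
  fixes f :: "'b::real_normed_vector \<Rightarrow> real"
  assumes add: "\<And>u v. f (u + v) = f u + f v" and bd: "\<And>v. \<bar>f v\<bar> \<le> C * norm v"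
  shows "f (r *\<^sub>R v) = r * f v"
proof -
  interpret additive f by standard (rule add)
  have fn: "f (of_nat n *\<^sub>R v) = of_nat n * f v" for n :: nat and v
    by (induction n) (auto simp: add zero algebra_simps)
  have fi: "f (of_int k *\<^sub>R v) = of_int k * f v" for k :: int and v
  proof (cases k)
    case (nonneg n) then show ?thesis using fn[of n v] by simp
  next
    case (neg n) then show ?thesis using fn[of "Suc n" v] minus[of "of_nat (Suc n) *\<^sub>R v"]
      by (simp del: of_nat_Suc)
  qed
  \<comment> \<open>With \<open>n * r = k + e\<close>, \<open>k\<close> an integer and
    \<open>0 \<le> e \<le> 1\<close>, the defect of homogeneity times \<open>n\<close> equals
    \<open>f (e *\<^sub>R v) - e * f v\<close>. So it is bounded independently of \<open>n\<close>,
    and the defect vanishes.\<close>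
  let ?K = "C * norm v + \<bar>f v\<bar>"
  have K0: "0 \<le> C * norm v" using bd[of v] by linarith
  have *: "of_nat n * \<bar>f (r *\<^sub>R v) - r * f v\<bar> \<le> ?K" for n :: nat
  proof -
    define k where "k = \<lfloor>of_nat n * r\<rfloor>"
    define e where "e = of_nat n * r - of_int k"
    have e: "0 \<le> e" "e \<le> 1" unfolding e_def k_def by linarith+
    have "of_nat n * f (r *\<^sub>R v) = f ((of_int k + e) *\<^sub>R v)"
      using fn[of n "r *\<^sub>R v"] by (simp add: e_def)
    also have "\<dots> = of_int k * f v + f (e *\<^sub>R v)"
      by (simp add: scaleR_add_left add fi)
    finally have "of_nat n * (f (r *\<^sub>R v) - r * f v) = f (e *\<^sub>R v) - e * f v"
      by (simp add: e_def algebra_simps)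
    then have "of_nat n * \<bar>f (r *\<^sub>R v) - r * f v\<bar> = \<bar>f (e *\<^sub>R v) - e * f v\<bar>"
      by (metis abs_mult abs_of_nat)
    also have "\<dots> \<le> \<bar>f (e *\<^sub>R v)\<bar> + \<bar>e * f v\<bar>" by linarith
    also have "\<bar>f (e *\<^sub>R v)\<bar> \<le> e * (C * norm v)" using bd[of "e *\<^sub>R v"] e by (simp add: ac_simps)
    also have "e * (C * norm v) \<le> 1 * (C * norm v)" using e K0 by (intro mult_right_mono) auto
    also have "\<bar>e * f v\<bar> \<le> 1 * \<bar>f v\<bar>" unfolding abs_mult using e by (intro mult_right_mono) auto
    finally show ?thesis by simp
  qed
  have "\<bar>f (r *\<^sub>R v) - r * f v\<bar> = 0"
  proof (rule ccontr)
    assume "\<bar>f (r *\<^sub>R v) - r * f v\<bar> \<noteq> 0"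
    then have "0 < \<bar>f (r *\<^sub>R v) - r * f v\<bar>" by linarith
    from reals_Archimedean3[OF this, rule_format, of ?K] * show False
      by (meson not_le)
  qed
  then show ?thesis by simp
qed

text \<open>Sums and differences must stay in the dense set, so that additivity can be imposed on
  all pairs outside one null set. Finite sums of elements of a dense set and their negatives achieve
  this and remain countable.\<close>

lemma countable_dense_subgroup:
  obtains D :: "'b::{real_normed_vector, second_countable_topology} set" where
    "countable D" "\<And>u v. u \<in> D \<Longrightarrow> v \<in> D \<Longrightarrow> u + v \<in> D" "\<And>u. u \<in> D \<Longrightarrow> - u \<in> D"
    "\<And>v e. e > 0 \<Longrightarrow> \<exists>d\<in>D. norm (d - v) < e"
proof -
  obtain D0 :: "'b set" where D0: "countable D0" "\<And>X. open X \<Longrightarrow> X \<noteq> {} \<Longrightarrow> \<exists>d\<in>D0. d \<in> X"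
    using countable_dense_exists by blast
  define S where "S = D0 \<union> uminus ` D0"
  show thesis
  proof (rule that[of "sum_list ` lists S"])
    show "countable (sum_list ` lists S)" using D0(1) unfolding S_def by auto
    show "u + v \<in> sum_list ` lists S" if "u \<in> sum_list ` lists S" "v \<in> sum_list ` lists S" for u v
    proof -
      from that obtain xs ys where "u = sum_list xs" "v = sum_list ys" "xs \<in> lists S" "ys \<in> lists S" by blast
      then have "u + v = sum_list (xs @ ys)" "xs @ ys \<in> lists S" by auto
      then show ?thesis by blast
    qed
    show "- u \<in> sum_list ` lists S" if "u \<in> sum_list ` lists S" for u
    proof -
      from that obtain xs where xs: "u = sum_list xs" "xs \<in> lists S" by blast
      have "- u = sum_list (map uminus xs)" unfolding xs(1) by (induction xs) auto
      moreover have "map uminus xs \<in> lists S" using xs(2) unfolding S_def by (induction xs) auto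
      ultimately show ?thesis by blast
    qed
    fix v :: 'b and e :: real assume "e > 0"
    then obtain d where d: "d \<in> D0" "d \<in> ball v e" using D0(2)[of "ball v e"] by auto
    then have "d = sum_list [d]" "[d] \<in> lists S" unfolding S_def by auto
    then have "d \<in> sum_list ` lists S" by blast
    with d show "\<exists>d\<in>sum_list ` lists S. norm (d - v) < e"
      by (auto simp: dist_norm norm_minus_commute)
  qed
qed

section \<open>Weak* conditional expectation\<close>

text \<open>Each \<open>h v\<close> is controlled only up to a null set depending on
  \<open>v\<close>, so \<open>\<lambda>v. h v y\<close> need not be additive for any given
  \<open>y\<close>. Outside a single null set it is additive and Lipschitz with constant
  \<open>C\<close> on a countable dense subgroup, and it extends from there by continuity.\<close>

lemma weakstar_measurable_of_additive_family:
  fixes h :: "'b::{banach, second_countable_topology} \<Rightarrow> 'y \<Rightarrow> real"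
  assumes h[measurable]: "\<And>v. h v \<in> borel_measurable M"
    and add: "\<And>u v. AE y in M. h (u + v) y = h u y + h v y"
    and bd: "\<And>v. AE y in M. \<bar>h v y\<bar> \<le> C * norm v"
    and C: "0 \<le> C"
  obtains F :: "'y \<Rightarrow> 'b \<Rightarrow>\<^sub>L real" where
    "\<And>v. (\<lambda>y. F y v) \<in> borel_measurable M" "\<And>y. norm (F y) \<le> C" "\<And>v. AE y in M. F y v = h v y"
proof -
  obtain D :: "'b set" where D: "countable D" "\<And>u v. u \<in> D \<Longrightarrow> v \<in> D \<Longrightarrow> u + v \<in> D"
    "\<And>u. u \<in> D \<Longrightarrow> - u \<in> D" "\<And>v e. e > 0 \<Longrightarrow> \<exists>d\<in>D. norm (d - v) < e"
    using countable_dense_subgroup by metis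
  define P where "P y \<longleftrightarrow> (\<forall>u\<in>D. \<forall>v\<in>D. h (u + v) y = h u y + h v y) \<and> (\<forall>v\<in>D. \<bar>h v y\<bar> \<le> C * norm v)" for y
  have "AE y in M. P y" unfolding P_def
    by (intro AE_conjI AE_ball_countable[THEN iffD2] ballI D(1) add bd)
  then obtain N where N: "N \<in> null_sets M" "{y \<in> space M. \<not> P y} \<subseteq> N"
    by (auto simp: eventually_ae_filter)
  define G where "G = space M - N"
  have G[measurable]: "G \<in> sets M" and GP: "\<And>y. y \<in> G \<Longrightarrow> P y" and AEG: "AE y in M. y \<in> G"
    using N AE_not_in[OF N(1)] unfolding G_def by auto
  obtain d :: "nat \<Rightarrow> 'b \<Rightarrow> 'b" where d: "\<And>n v. d n v \<in> D" "\<And>n v. norm (d n v - v) < 1 / Suc n"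
  proof -
    have "\<exists>e. e \<in> D \<and> norm (e - v) < 1 / Suc n" for n v
      using D(4)[of "1 / Suc n" v] by auto
    then show thesis using that[of "\<lambda>n v. SOME e. e \<in> D \<and> norm (e - v) < 1 / Suc n"]
      by (metis (mono_tags, lifting) someI_ex)
  qed
  have d_lim: "(\<lambda>n. d n v) \<longlonglongrightarrow> v" for v
  proof (rule LIM_zero_cancel, rule Lim_null_comparison)
    show "\<forall>\<^sub>F n in sequentially. norm (d n v - v) \<le> 1 / Suc n"
      using d(2)[of _ v] by (intro always_eventually) (auto intro: less_imp_le)
    show "(\<lambda>n. 1 / real (Suc n)) \<longlonglongrightarrow> 0" by (rule LIMSEQ_Suc[OF lim_1_over_n])
  qed
  have h_diff: "h (u - v) y = h u y - h v y" if "y \<in> G" "u \<in> D" "v \<in> D" for u v y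
  proof -
    have "h ((u + - v) + v) y = h (u + - v) y + h v y"
      using GP[OF that(1)] D(2,3) that unfolding P_def by blast
    then show ?thesis by simp
  qed
  have h_lip: "\<bar>h u y - h v y\<bar> \<le> C * norm (u - v)" if "y \<in> G" "u \<in> D" "v \<in> D" for u v y
    using GP[OF that(1)] D(2)[OF that(2) D(3)[OF that(3)]] h_diff[OF that] unfolding P_def by auto
  \<comment> \<open>The value 0 off \<open>G\<close> is additive and bounded by \<open>C\<close>
    too, so \<open>f y\<close> becomes a functional for every \<open>y\<close>.\<close>
  define f where "f y v = (if y \<in> G then lim (\<lambda>n. h (d n v) y) else 0)" for y v
  have f_lim: "(\<lambda>n. h (d n v) y) \<longlonglongrightarrow> f y v" if y: "y \<in> G" for y v
  proof -
    have "Cauchy (\<lambda>n. h (d n v) y)"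
    proof (rule metric_CauchyI)
      fix e :: real assume e: "e > 0"
      have "e / (C + 1) > 0" using e C by simp
      moreover have "Cauchy (\<lambda>n. d n v)" using d_lim LIMSEQ_imp_Cauchy by blast
      ultimately obtain K where K: "\<And>m n. m \<ge> K \<Longrightarrow> n \<ge> K \<Longrightarrow> dist (d m v) (d n v) < e / (C + 1)"
        unfolding Cauchy_def by meson
      have "dist (h (d m v) y) (h (d n v) y) < e" if "m \<ge> K" "n \<ge> K" for m n
      proof -
        have "dist (h (d m v) y) (h (d n v) y) \<le> C * dist (d m v) (d n v)"
          using h_lip[OF y d(1) d(1)] by (simp add: dist_norm)
        also have "\<dots> \<le> (C + 1) * dist (d m v) (d n v)" by (intro mult_right_mono) auto
        also have "\<dots> < e" using K[OF that] C by (simp add: field_simps)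
        finally show ?thesis .
      qed
      then show "\<exists>K. \<forall>m\<ge>K. \<forall>n\<ge>K. dist (h (d m v) y) (h (d n v) y) < e" by blast
    qed
    then show ?thesis using y by (simp add: f_def Cauchy_convergent_iff convergent_LIMSEQ_iff)
  qed
  \<comment> \<open>Independence of the approximating sequence is what gives additivity:
    \<open>d n u + d n v\<close> tends to \<open>u + v\<close> but is in general not
    \<open>d n (u + v)\<close>.\<close>
  have f_eq: "f y v = l" if y: "y \<in> G" and e: "\<And>n. e n \<in> D" "e \<longlonglongrightarrow> v" "(\<lambda>n. h (e n) y) \<longlonglongrightarrow> l" for y v e l
  proof (rule LIMSEQ_unique[OF _ e(3)])
    have "(\<lambda>n. h (e n) y - h (d n v) y) \<longlonglongrightarrow> 0"
    proof (rule Lim_null_comparison)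
      show "\<forall>\<^sub>F n in sequentially. norm (h (e n) y - h (d n v) y) \<le> C * norm (e n - d n v)"
        using h_lip[OF y e(1) d(1)] by (intro always_eventually) auto
      have "(\<lambda>n. C * norm (e n - d n v)) \<longlonglongrightarrow> C * norm (v - v)"
        by (intro tendsto_intros e d_lim)
      then show "(\<lambda>n. C * norm (e n - d n v)) \<longlonglongrightarrow> 0" by simp
    qed
    from tendsto_add[OF this f_lim[OF y, of v]] show "(\<lambda>n. h (e n) y) \<longlonglongrightarrow> f y v" by simp
  qed
  have f_add: "f y (u + v) = f y u + f y v" for y u v
  proof (cases "y \<in> G")
    case True
    have "(\<lambda>n. h (d n u + d n v) y) = (\<lambda>n. h (d n u) y + h (d n v) y)"
      using GP[OF True] d(1) unfolding P_def by auto
    then have "(\<lambda>n. h (d n u + d n v) y) \<longlonglongrightarrow> f y u + f y v"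
      using tendsto_add[OF f_lim[OF True, of u] f_lim[OF True, of v]] by simp
    then show ?thesis by (rule f_eq[OF True D(2)[OF d(1) d(1)] tendsto_add[OF d_lim d_lim]])
  qed (simp add: f_def)
  have f_bd: "\<bar>f y v\<bar> \<le> C * norm v" for y v
  proof (cases "y \<in> G")
    case True
    have "(\<lambda>n. C * norm (d n v)) \<longlonglongrightarrow> C * norm v" by (intro tendsto_intros d_lim)
    moreover have "(\<lambda>n. \<bar>h (d n v) y\<bar>) \<longlonglongrightarrow> \<bar>f y v\<bar>" by (intro tendsto_intros f_lim True)
    ultimately show ?thesis
      using GP[OF True] d(1) unfolding P_def by (intro LIMSEQ_le) auto
  qed (use C in \<open>simp add: f_def\<close>)
  have bl: "bounded_linear (f y)" for y
    by (rule bounded_linear_intro[where K = C])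
      (use f_add f_bd bounded_additive_scaleR[of "f y" C, OF f_add f_bd] in \<open>auto simp: ac_simps\<close>)
  define F where "F y = Blinfun (f y)" for y
  have F: "blinfun_apply (F y) = f y" for y unfolding F_def by (rule bounded_linear_Blinfun_apply[OF bl])
  show thesis
  proof (rule that[of F])
    show "(\<lambda>y. F y v) \<in> borel_measurable M" for v
    proof (rule borel_measurable_LIMSEQ_metric)
      show "(\<lambda>y. indicator G y * h (d n v) y) \<in> borel_measurable M" for n by measurable
      show "(\<lambda>n. indicator G y * h (d n v) y) \<longlonglongrightarrow> F y v" for y
        unfolding F using f_lim[of y v] by (cases "y \<in> G") (auto simp: f_def)
    qed
    show "norm (F y) \<le> C" for y
      by (rule norm_blinfun_bound[OF C]) (use f_bd in \<open>simp add: F\<close>)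
    show "AE y in M. F y v = h v y" for v
    proof -
      \<comment> \<open>A vector outside \<open>D\<close> is not covered by \<open>P\<close>.
        Splitting \<open>d n v\<close> as \<open>(d n v - v) + v\<close> compares
        \<open>h (d n v)\<close> with \<open>h v\<close>, at the cost of a null set that depends on
        \<open>v\<close>.\<close>
      have "AE y in M. \<forall>n. h ((d n v - v) + v) y = h (d n v - v) y + h v y"
        "AE y in M. \<forall>n. \<bar>h (d n v - v) y\<bar> \<le> C * norm (d n v - v)"
        unfolding AE_all_countable by (intro allI add bd)+
      with AEG show ?thesis
      proof eventually_elim
        case (elim y)
        have "(\<lambda>n. h (d n v - v) y) \<longlonglongrightarrow> 0"
        proof (rule Lim_null_comparison)
          show "\<forall>\<^sub>F n in sequentially. norm (h (d n v - v) y) \<le> C * norm (d n v - v)"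
            using elim by (intro always_eventually) auto
          have "(\<lambda>n. C * norm (d n v - v)) \<longlonglongrightarrow> C * norm (v - v)" by (intro tendsto_intros d_lim)
          then show "(\<lambda>n. C * norm (d n v - v)) \<longlonglongrightarrow> 0" by simp
        qed
        from tendsto_add[OF this tendsto_const[of "h v y"]] elim
        have "(\<lambda>n. h (d n v) y) \<longlonglongrightarrow> h v y" by simp
        then show ?case unfolding F by (rule f_eq[OF elim(1) d(1) d_lim])
      qed
    qed
  qed
qed

text \<open>The hypothesis speaks of constant vectors. A simple \<open>w\<close> takes finitely many
  of them, and a measurable \<open>w\<close> is a pointwise limit of simple functions, through which
  the continuous \<open>\<beta> x\<close> passes.\<close>

lemma borel_measurable_weakstar_apply:
  fixes \<beta> :: "'z \<Rightarrow> 'b::{banach, second_countable_topology} \<Rightarrow>\<^sub>L real"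
  assumes \<beta>: "\<And>v. (\<lambda>x. \<beta> x v) \<in> borel_measurable M" and w[measurable]: "w \<in> borel_measurable M"
  shows "(\<lambda>x. \<beta> x (w x)) \<in> borel_measurable M"
proof -
  obtain s where s: "\<And>i. simple_function M (s i)" "\<And>x. x \<in> space M \<Longrightarrow> (\<lambda>i. s i x) \<longlonglongrightarrow> w x"
    using borel_measurable_implies_sequence_metric[OF w, of 0] by metis
  show ?thesis
  proof (rule borel_measurable_LIMSEQ_metric)
    show "(\<lambda>x. \<beta> x (s i x)) \<in> borel_measurable M" for i
    proof (rule measurable_compose_countable'[where I = "s i ` space M"])
      show "s i \<in> M \<rightarrow>\<^sub>M count_space (s i ` space M)"
        using s(1)[of i] by (auto simp: simple_function_def measurable_count_space_eq2)
      show "countable (s i ` space M)" using s(1)[of i] by (intro countable_finite simple_functionD(1))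
    qed (rule \<beta>)
    show "(\<lambda>i. \<beta> x (s i x)) \<longlonglongrightarrow> \<beta> x (w x)" if "x \<in> space M" for x
      by (intro tendsto_intros s that)
  qed
qed

lemma integrable_weakstar_apply:
  fixes \<beta> :: "'z \<Rightarrow> 'b::{banach, second_countable_topology} \<Rightarrow>\<^sub>L real"
  assumes \<beta>: "\<And>v. (\<lambda>x. \<beta> x v) \<in> borel_measurable M" and bd: "AE x in M. norm (\<beta> x) \<le> C"
    and w: "integrable M w"
  shows "integrable M (\<lambda>x. \<beta> x (w x))"
proof (rule Bochner_Integration.integrable_bound)
  show "integrable M (\<lambda>x. C * norm (w x))" using w by auto
  show "(\<lambda>x. \<beta> x (w x)) \<in> borel_measurable M"
    by (rule borel_measurable_weakstar_apply[OF \<beta> borel_measurable_integrable[OF w]])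
  show "AE x in M. norm (\<beta> x (w x)) \<le> norm (C * norm (w x))"
    using bd
  proof eventually_elim
    case (elim x)
    have "norm (\<beta> x (w x)) \<le> norm (\<beta> x) * norm (w x)" by (rule norm_blinfun)
    also have "\<dots> \<le> C * norm (w x)" using elim by (rule mult_right_mono) simp
    finally show ?case by simp
  qed
qed

section \<open>Measure preserving maps and conditional expectation along them\<close>

locale measure_preserving_map =
  fixes X :: "'x measure" and Y :: "'y measure" and T :: "'x \<Rightarrow> 'y"
  assumes prob_X: "prob_space X" and T[measurable]: "T \<in> X \<rightarrow>\<^sub>M Y" and distr_T: "distr X Y T = Y"
begin

sublocale X: prob_space X by (rule prob_X)

sublocale Y: prob_space Y
  using X.prob_space_distr[OF T] by (simp add: distr_T)

lemma AE_preimage: "(AE y in Y. P y) \<Longrightarrow> AE x in X. P (T x)"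
  using AE_distrD[OF T, of P] unfolding distr_T .

lemma integral_preimage:
  fixes f :: "'y \<Rightarrow> 'c::{banach, second_countable_topology}"
  assumes "f \<in> borel_measurable Y"
  shows "(\<integral>x. f (T x) \<partial>X) = (\<integral>y. f y \<partial>Y)"
  using integral_distr[OF T assms] by (simp add: distr_T)

lemma integrable_preimage:
  fixes f :: "'y \<Rightarrow> 'c::{banach, second_countable_topology}"
  assumes "integrable Y f"
  shows "integrable X (\<lambda>x. f (T x))"
  using integrable_distr[OF T, of f] assms by (simp add: distr_T)

text \<open>\<open>h\<close> is the conditional expectation of \<open>f\<close>, as a function on
  \<open>Y\<close>. The map \<open>T\<close> pushes the measure with density \<open>f + C\<close> to
  one that is absolutely continuous with respect to \<open>Y\<close>; with \<open>D\<close> its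
  derivative, \<open>h\<close> is \<open>D - C\<close>.\<close>

lemma real_cond_exp_exists:
  fixes f :: "'x \<Rightarrow> real"
  assumes f[measurable]: "f \<in> borel_measurable X" and bd: "AE x in X. \<bar>f x\<bar> \<le> C"
  obtains h where "h \<in> borel_measurable Y" "integrable Y h" "AE y in Y. \<bar>h y\<bar> \<le> C"
    "\<And>A. A \<in> sets Y \<Longrightarrow> (\<integral>y. indicator A y * h y \<partial>Y) = (\<integral>x. indicator A (T x) * f x \<partial>X)"
proof -
  have int_f: "integrable X f" using bd by (intro X.integrable_const_bound[of _ C]) auto
  \<comment> \<open>The shift by \<open>C\<close> makes the density nonnegative almost everywhere,
    so that a function of varying sign is handled by a measure.\<close>
  define M where "M = distr (density X (\<lambda>x. ennreal (f x + C))) Y T"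
  have sM[simp, measurable_cong]: "sets M = sets Y" by (simp add: M_def)
  have nn: "AE x in X. 0 \<le> f x + C" using bd by eventually_elim auto
  have emM: "emeasure M A = (\<integral>\<^sup>+x. ennreal (indicator A (T x) * (f x + C)) \<partial>X)" if [measurable]: "A \<in> sets Y" for A
  proof -
    have "emeasure M A = (\<integral>\<^sup>+x. ennreal (f x + C) * indicator (T -` A \<inter> space X) x \<partial>X)"
      unfolding M_def by (subst emeasure_distr) (auto simp: emeasure_density)
    also have "\<dots> = (\<integral>\<^sup>+x. ennreal (indicator A (T x) * (f x + C)) \<partial>X)"
      by (intro nn_integral_cong) (auto simp: indicator_def)
    finally show ?thesis .
  qed
  have int1: "integrable X (\<lambda>x. indicator A (T x) * (f x + C))" if [measurable]: "A \<in> sets Y" for A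
    using integrable_real_mult_indicator[of "T -` A \<inter> space X" X "\<lambda>x. f x + C"] int_f
    by (subst Bochner_Integration.integrable_cong[OF refl, of _ _ "\<lambda>x. (f x + C) * indicator (T -` A \<inter> space X) x"])
       (auto simp: indicator_def)
  have emM': "emeasure M A = ennreal (\<integral>x. indicator A (T x) * (f x + C) \<partial>X)" if "A \<in> sets Y" for A
    unfolding emM[OF that] using nn
    by (intro nn_integral_eq_integral int1[OF that]) (auto elim!: eventually_mono simp: indicator_def)
  have fin: "finite_measure M"
    by (rule finite_measureI) (simp add: emM' sets_eq_imp_space_eq[OF sM])
  have ac: "absolutely_continuous Y M"
    unfolding absolutely_continuous_def
  proof
    fix A assume A: "A \<in> null_sets Y"
    then have [measurable]: "A \<in> sets Y" by auto
    have "AE x in X. T x \<notin> A" using AE_preimage[OF AE_not_in[OF A]] .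
    then have "emeasure M A = (\<integral>\<^sup>+x. 0 \<partial>X)"
      unfolding emM[OF \<open>A \<in> sets Y\<close>] by (intro nn_integral_cong_AE) (auto elim!: eventually_mono)
    then show "A \<in> null_sets M" by (auto intro!: null_setsI)
  qed
  obtain D where D: "D \<in> borel_measurable Y" "AE y in Y. RN_deriv Y M y = ennreal (D y)" "\<And>y. 0 \<le> D y"
    using Y.real_RN_deriv[OF fin ac sM] by metis
  note [measurable] = D(1)
  have D_em: "(\<integral>\<^sup>+y. ennreal (indicator A y * D y) \<partial>Y) = emeasure M A" if [measurable]: "A \<in> sets Y" for A
  proof -
    have "emeasure M A = emeasure (density Y (RN_deriv Y M)) A"
      by (simp add: Y.density_RN_deriv[OF ac sM])
    also have "\<dots> = (\<integral>\<^sup>+y. RN_deriv Y M y * indicator A y \<partial>Y)" by (simp add: emeasure_density)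
    also have "\<dots> = (\<integral>\<^sup>+y. ennreal (indicator A y * D y) \<partial>Y)"
      using D(2) by (intro nn_integral_cong_AE) (auto elim!: eventually_mono simp: indicator_def)
    finally show ?thesis by simp
  qed
  have int_D: "integrable Y D"
  proof (rule integrableI_nonneg)
    have "(\<integral>\<^sup>+y. ennreal (D y) \<partial>Y) = (\<integral>\<^sup>+y. ennreal (indicator (space Y) y * D y) \<partial>Y)"
      by (intro nn_integral_cong) auto
    then show "(\<integral>\<^sup>+y. ennreal (D y) \<partial>Y) < \<infinity>" using emM'[of "space Y"] D_em[of "space Y"] by simp
  qed (use D(3) in auto)
  have D_int: "(\<integral>y. indicator A y * D y \<partial>Y) = (\<integral>x. indicator A (T x) * (f x + C) \<partial>X)" if [measurable]: "A \<in> sets Y" for A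
  proof -
    have "(\<integral>y. indicator A y * D y \<partial>Y) = enn2real (\<integral>\<^sup>+y. ennreal (indicator A y * D y) \<partial>Y)"
      using D(3) by (intro integral_eq_nn_integral) auto
    also have "\<dots> = (\<integral>x. indicator A (T x) * (f x + C) \<partial>X)"
      unfolding D_em[OF that] emM[OF that] using nn
      by (intro integral_eq_nn_integral[symmetric]) (auto elim!: eventually_mono simp: indicator_def)
    finally show ?thesis .
  qed
  define h where "h y = D y - C" for y
  have [measurable]: "h \<in> borel_measurable Y" unfolding h_def by measurable
  have int_h: "integrable Y h" unfolding h_def using int_D by auto
  have intA: "integrable Y (\<lambda>y. indicator A y * g y)" if "A \<in> sets Y" "integrable Y g" for A and g :: "'y \<Rightarrow> real"
    using integrable_real_mult_indicator[OF that] by (simp add: mult.commute)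
  have intAT: "integrable X (\<lambda>x. indicator A (T x) * f x)" if "A \<in> sets Y" for A
  proof (rule X.integrable_const_bound[of _ C])
    show "AE x in X. norm (indicator A (T x) * f x) \<le> C"
      using bd by eventually_elim (auto simp: indicator_def)
  qed (use that in measurable)
  have h_eq: "(\<integral>y. indicator A y * h y \<partial>Y) = (\<integral>x. indicator A (T x) * f x \<partial>X)" if [measurable]: "A \<in> sets Y" for A
  proof -
    have "(\<integral>y. indicator A y * h y \<partial>Y) = (\<integral>y. indicator A y * D y \<partial>Y) - (\<integral>y. indicator A y * C \<partial>Y)"
      unfolding h_def right_diff_distrib by (intro Bochner_Integration.integral_diff intA int_D) auto
    also have "(\<integral>y. indicator A y * C \<partial>Y) = (\<integral>x. indicator A (T x) * C \<partial>X)"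
      by (rule integral_preimage[symmetric]) measurable
    also have "(\<integral>y. indicator A y * D y \<partial>Y) - \<dots> = (\<integral>x. indicator A (T x) * (f x + C) - indicator A (T x) * C \<partial>X)"
      unfolding D_int[OF that]
      by (rule Bochner_Integration.integral_diff[symmetric, OF int1[OF that]])
        (intro integrable_preimage[of "\<lambda>y. indicator A y * C"] intA, auto)
    finally show ?thesis by (simp add: algebra_simps)
  qed
  \<comment> \<open>The signs 1 and -1 give the two bounds on \<open>h\<close>. Each is tested by
    integrals over sets, which turn it into the corresponding bound on \<open>f\<close>.\<close>
  have sign: "AE y in Y. 0 \<le> C - s * h y" if s: "\<bar>s\<bar> = 1" for s :: real
  proof (rule Y.density_nonneg)
    show "integrable Y (\<lambda>y. C - s * h y)" using int_h by auto
    fix A assume A[measurable]: "A \<in> sets Y"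
    have "(\<integral>y. indicator A y * (C - s * h y) \<partial>Y) = (\<integral>y. indicator A y * C \<partial>Y) - (\<integral>y. s * (indicator A y * h y) \<partial>Y)"
      by (subst Bochner_Integration.integral_diff[symmetric])
        (intro integrable_mult_right intA int_h A Y.integrable_const | simp add: algebra_simps)+
    also have "(\<integral>y. indicator A y * C \<partial>Y) = (\<integral>x. indicator A (T x) * C \<partial>X)"
      by (rule integral_preimage[symmetric]) measurable
    also have "(\<integral>y. s * (indicator A y * h y) \<partial>Y) = (\<integral>x. s * (indicator A (T x) * f x) \<partial>X)"
      by (simp only: integral_mult_right_zero h_eq[OF A])
    also have "(\<integral>x. indicator A (T x) * C \<partial>X) - \<dots> = (\<integral>x. indicator A (T x) * C - s * (indicator A (T x) * f x) \<partial>X)"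
      by (intro Bochner_Integration.integral_diff[symmetric] integrable_mult_right intAT A
          integrable_preimage[of "\<lambda>y. indicator A y * C"] intA) auto
    also have "\<dots> \<ge> 0"
    proof (rule integral_nonneg_AE, use bd in eventually_elim)
      case (elim x)
      have "s * f x \<le> \<bar>s * f x\<bar>" by simp
      also have "\<dots> \<le> C" using elim s by (simp add: abs_mult)
      finally show ?case by (auto simp: indicator_def)
    qed
    finally show "set_lebesgue_integral Y A (\<lambda>y. C - s * h y) \<ge> 0"
      by (simp add: set_lebesgue_integral_def)
  qed
  show thesis
  proof (rule that[of h])
    show "AE y in Y. \<bar>h y\<bar> \<le> C" using sign[of 1] sign[of "-1"] by auto
  qed (use int_h h_eq in auto)
qed

text \<open>The conditional expectation of \<open>\<beta>\<close> along \<open>T\<close>, as a function \<open>F\<close> on \<open>Y\<close>. Testing against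
  vector-valued functions instead of constant vectors is what makes it commute with the
  operators \<open>Lflat\<close>, which vary with the point of \<open>Y\<close>.\<close>

definition weakstar_cond_exp ::
  "('x \<Rightarrow> 'b::{banach, second_countable_topology} \<Rightarrow>\<^sub>L real) \<Rightarrow> ('y \<Rightarrow> 'b \<Rightarrow>\<^sub>L real) \<Rightarrow> bool"
  where "weakstar_cond_exp \<beta> F \<longleftrightarrow>
    (\<forall>w. integrable Y w \<longrightarrow> (\<integral>x. \<beta> x (w (T x)) \<partial>X) = (\<integral>y. F y (w y) \<partial>Y))"

text \<open>The scalar expectations of \<open>\<beta> x v\<close> are additive in \<open>v\<close>
  almost everywhere, since both sides have the same integrals over sets, so they glue to
  functionals. The tested identity holds by construction for an indicator times a vector and passes
  to integrable \<open>w\<close> by linearity and limits.\<close>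

lemma weakstar_cond_exp_exists:
  fixes \<beta> :: "'x \<Rightarrow> 'b::{banach, second_countable_topology} \<Rightarrow>\<^sub>L real"
  assumes \<beta>: "\<And>v. (\<lambda>x. \<beta> x v) \<in> borel_measurable X" and bd: "AE x in X. norm (\<beta> x) \<le> C" and C: "0 \<le> C"
  obtains F :: "'y \<Rightarrow> 'b \<Rightarrow>\<^sub>L real" where "\<And>v. (\<lambda>y. F y v) \<in> borel_measurable Y" "\<And>y. norm (F y) \<le> C" "weakstar_cond_exp \<beta> F"
proof -
  have bdv: "AE x in X. \<bar>\<beta> x v\<bar> \<le> C * norm v" for v
    using bd
  proof eventually_elim
    case (elim x)
    have "\<bar>\<beta> x v\<bar> \<le> norm (\<beta> x) * norm v" using norm_blinfun[of "\<beta> x" v] by simp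
    also have "\<dots> \<le> C * norm v" using elim by (rule mult_right_mono) simp
    finally show ?case .
  qed
  define P where "P v h \<longleftrightarrow> h \<in> borel_measurable Y \<and> integrable Y h \<and> (AE y in Y. \<bar>h y\<bar> \<le> C * norm v) \<and>
    (\<forall>A\<in>sets Y. (\<integral>y. indicator A y * h y \<partial>Y) = (\<integral>x. indicator A (T x) * \<beta> x v \<partial>X))" for v h
  have "\<exists>h. P v h" for v
    unfolding P_def by (rule real_cond_exp_exists[OF \<beta> bdv[of v]]) blast
  then obtain h where "\<And>v. P v (h v)" by metis
  then have h: "\<And>v. h v \<in> borel_measurable Y" "\<And>v. integrable Y (h v)"
      "\<And>v. AE y in Y. \<bar>h v y\<bar> \<le> C * norm v"
      "\<And>v A. A \<in> sets Y \<Longrightarrow> (\<integral>y. indicator A y * h v y \<partial>Y) = (\<integral>x. indicator A (T x) * \<beta> x v \<partial>X)"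
    unfolding P_def by blast+
  have int_ind: "integrable X (\<lambda>x. indicator A (T x) * \<beta> x v)" if [measurable]: "A \<in> sets Y" for A v
  proof -
    have "integrable X (\<lambda>x. \<beta> x (indicator A (T x) *\<^sub>R v))"
      by (intro integrable_weakstar_apply[OF \<beta> bd] integrable_preimage[of "\<lambda>y. indicator A y *\<^sub>R v"])
        (auto intro!: integrable_scaleR_left Y.integrable_const_bound[of _ 1])
    then show ?thesis by (simp add: blinfun.scaleR_right)
  qed
  have add: "AE y in Y. h (u + v) y = h u y + h v y" for u v
  proof (rule density_unique_real)
    show "integrable Y (\<lambda>y. h u y + h v y)" by (intro Bochner_Integration.integrable_add h)
    fix A assume A: "A \<in> sets Y"
    have i: "integrable Y (\<lambda>y. indicator A y * h v y)" for v
      using integrable_real_mult_indicator[OF A h(2)[of v]] by (simp add: mult.commute)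
    have "(\<integral>y. indicator A y * h (u + v) y \<partial>Y) = (\<integral>x. indicator A (T x) * \<beta> x u + indicator A (T x) * \<beta> x v \<partial>X)"
      unfolding h(4)[OF A] by (simp add: blinfun.add_right algebra_simps)
    also have "\<dots> = (\<integral>y. indicator A y * h u y + indicator A y * h v y \<partial>Y)"
      by (subst (1 2) Bochner_Integration.integral_add) (simp_all add: int_ind A i h(4))
    finally show "(LINT y:A|Y. h (u + v) y) = (LINT y:A|Y. h u y + h v y)"
      by (simp add: set_lebesgue_integral_def algebra_simps)
  qed (rule h)
  obtain F :: "'y \<Rightarrow> 'b \<Rightarrow>\<^sub>L real" where F: "\<And>v. (\<lambda>y. F y v) \<in> borel_measurable Y"
      "\<And>y. norm (F y) \<le> C" "\<And>v. AE y in Y. F y v = h v y"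
    by (rule weakstar_measurable_of_additive_family[OF h(1) add h(3) C]) (blast intro: that)
  have F_bd: "AE y in Y. norm (F y) \<le> C" using F(2) by simp
  have "(\<integral>x. \<beta> x (w (T x)) \<partial>X) = (\<integral>y. F y (w y) \<partial>Y)" if "integrable Y w" for w
    using that
  proof (induction w rule: integrable_induct)
    case (base A v)
    have "(\<integral>y. F y (indicator A y *\<^sub>R v) \<partial>Y) = (\<integral>y. indicator A y * h v y \<partial>Y)"
      using F(3)[of v] base F(1)[of v] h(1)[of v]
      by (intro integral_cong_AE) (auto simp: blinfun.scaleR_right)
    then show ?case by (simp add: blinfun.scaleR_right h(4)[OF base(1)])
  next
    case (add f g)
    show ?case unfolding blinfun.add_right using add
      by (subst (1 2) Bochner_Integration.integral_add)
        (auto intro: integrable_weakstar_apply[OF \<beta> bd] integrable_weakstar_apply[OF F(1) F_bd] integrable_preimage)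
  next
    case (lim f s)
    have [measurable]: "f \<in> borel_measurable Y" "\<And>i. s i \<in> borel_measurable Y" using lim by auto
    have "(\<lambda>i. \<integral>x. \<beta> x (s i (T x)) \<partial>X) \<longlonglongrightarrow> (\<integral>x. \<beta> x (f (T x)) \<partial>X)"
    proof (rule integral_dominated_convergence)
      \<comment> \<open>The factor 2 is the one in \<open>integrable_induct\<close>, whose
        approximations satisfy \<open>norm (s i y) \<le> 2 * norm (f y)\<close>.\<close>
      show "integrable X (\<lambda>x. C * (2 * norm (f (T x))))"
        using integrable_preimage[of "\<lambda>y. C * (2 * norm (f y))"] lim by auto
      show "AE x in X. norm (\<beta> x (s i (T x))) \<le> C * (2 * norm (f (T x)))" for i
        using bd AE_space
      proof eventually_elim
        case (elim x)
        have "norm (\<beta> x (s i (T x))) \<le> norm (\<beta> x) * norm (s i (T x))" by (rule norm_blinfun)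
        also have "\<dots> \<le> C * (2 * norm (f (T x)))"
          using elim C lim.hyps(3)[OF measurable_space[OF T elim(2)]] by (intro mult_mono) auto
        finally show ?case .
      qed
      show "AE x in X. (\<lambda>i. \<beta> x (s i (T x))) \<longlonglongrightarrow> \<beta> x (f (T x))"
        using measurable_space[OF T] by (intro AE_I2 tendsto_intros lim.hyps(2)) auto
    qed (auto intro!: borel_measurable_weakstar_apply[OF \<beta>])
    moreover have "(\<lambda>i. \<integral>y. F y (s i y) \<partial>Y) \<longlonglongrightarrow> (\<integral>y. F y (f y) \<partial>Y)"
    proof (rule integral_dominated_convergence)
      show "integrable Y (\<lambda>y. C * (2 * norm (f y)))" using lim by auto
      show "AE y in Y. norm (F y (s i y)) \<le> C * (2 * norm (f y))" for i
        using AE_space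
      proof eventually_elim
        case (elim y)
        have "norm (F y (s i y)) \<le> norm (F y) * norm (s i y)" by (rule norm_blinfun)
        also have "\<dots> \<le> C * (2 * norm (f y))"
          using elim C F(2) lim.hyps(3) by (intro mult_mono) auto
        finally show ?case .
      qed
      show "AE y in Y. (\<lambda>i. F y (s i y)) \<longlonglongrightarrow> F y (f y)"
        by (intro AE_I2 tendsto_intros lim.hyps(2)) auto
    qed (auto intro!: borel_measurable_weakstar_apply[OF F(1)])
    ultimately show ?case using lim.IH LIMSEQ_unique by simp
  qed
  then show thesis by (intro that[OF F(1,2)]) (simp add: weakstar_cond_exp_def)
qed

text \<open>A countable dense set of vectors makes the exceptional null set common to all vectors.
  Both the invariance of the descended cochain and its coboundary equation are obtained from
  integrals in this way.\<close>

lemma AE_eq_of_integral_apply_eq: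
  fixes F F' :: "'y \<Rightarrow> 'b::{banach, second_countable_topology} \<Rightarrow>\<^sub>L real"
  assumes F: "\<And>v. (\<lambda>y. F y v) \<in> borel_measurable Y" "AE y in Y. norm (F y) \<le> C"
    and F': "\<And>v. (\<lambda>y. F' y v) \<in> borel_measurable Y" "AE y in Y. norm (F' y) \<le> C'"
    and eq: "\<And>A v. A \<in> sets Y \<Longrightarrow>
      (\<integral>y. F y (indicator A y *\<^sub>R v) \<partial>Y) = (\<integral>y. F' y (indicator A y *\<^sub>R v) \<partial>Y)"
  shows "AE y in Y. F y = F' y"
proof -
  have *: "AE y in Y. F y v = F' y v" for v
  proof (rule density_unique_real)
    show "integrable Y (\<lambda>y. F y v)" "integrable Y (\<lambda>y. F' y v)"
      by (intro integrable_weakstar_apply[OF F] integrable_weakstar_apply[OF F'] Y.integrable_const)+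
    show "(LINT y:A|Y. F y v) = (LINT y:A|Y. F' y v)" if "A \<in> sets Y" for A
      using eq[OF that, of v] by (simp add: set_lebesgue_integral_def blinfun.scaleR_right)
  qed
  obtain D :: "'b set" where D: "countable D" "\<And>v e. e > 0 \<Longrightarrow> \<exists>d\<in>D. norm (d - v) < e"
    by (rule countable_dense_subgroup) blast
  have "AE y in Y. \<forall>v\<in>D. F y v = F' y v" using * D(1) by (simp add: AE_ball_countable)
  then show ?thesis
  proof eventually_elim
    case (elim y)
    have "closure D = UNIV"
      using D(2) by (auto simp: closure_approachable dist_norm)
    moreover have "closed {v. F y v = F' y v}" by (intro closed_Collect_eq continuous_intros)
    ultimately have "{v. F y v = F' y v} = UNIV"
      using elim closure_minimal[of D "{v. F y v = F' y v}"] by auto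
    then show ?case by (intro blinfun_eqI) auto
  qed
qed

end

section \<open>Tuples in a semidirect groupoid\<close>

locale semidirect_groupoid =
  fixes \<Gamma> :: "'g monoid" (structure) and X :: "'x measure" and act :: "'g \<Rightarrow> 'x \<Rightarrow> 'x"
    and \<nu> :: "('g \<times> 'x) measure" and \<kappa> :: "'x \<Rightarrow> ('g \<times> 'x) measure"
  assumes group: "group \<Gamma>" and countable_carrier: "countable (carrier \<Gamma>)"
    and standard: "standard_probability_space X" and pmp: "pmp_action \<Gamma> X act"
    and class_measure: "symmetric_class_measure (semidirect \<Gamma> X act) \<nu> \<kappa>"
begin

abbreviation "G \<equiv> semidirect \<Gamma> X act"

sublocale group \<Gamma> by (rule group)

sublocale group_action \<Gamma> "space X" act using pmp unfolding pmp_action_def by simp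

sublocale X: prob_space X using standard unfolding standard_probability_space_def by simp

lemma semidirect_simps [simp]:
  "arrows G = count_space (carrier \<Gamma>) \<Otimes>\<^sub>M X" "base G = X" "source G (g, x) = x" "target G (g, x) = act g x"
  "gmult G (g', x') (g, x) = (g' \<otimes> g, x)" "ginv G (g, x) = (inv g, act g x)"
  by (simp_all add: semidirect_def)

lemma act_measurable [measurable]: "g \<in> carrier \<Gamma> \<Longrightarrow> act g \<in> X \<rightarrow>\<^sub>M X"
  and distr_act: "g \<in> carrier \<Gamma> \<Longrightarrow> distr X X (act g) = X"
  using pmp unfolding pmp_action_def by auto

lemma act_in_space: "g \<in> carrier \<Gamma> \<Longrightarrow> x \<in> space X \<Longrightarrow> act g x \<in> space X"
  by (rule measurable_space[OF act_measurable])

lemma act_mult: "g \<in> carrier \<Gamma> \<Longrightarrow> h \<in> carrier \<Gamma> \<Longrightarrow> x \<in> space X \<Longrightarrow> act g (act h x) = act (g \<otimes> h) x"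
  by (simp add: composition_rule)

lemma act_one: "x \<in> space X \<Longrightarrow> act \<one> x = x"
  using id_eq_one by (metis restrict_apply')

lemma act_inv [simp]:
  "g \<in> carrier \<Gamma> \<Longrightarrow> x \<in> space X \<Longrightarrow> act g (act (inv g) x) = x"
  "g \<in> carrier \<Gamma> \<Longrightarrow> x \<in> space X \<Longrightarrow> act (inv g) (act g x) = x"
  by (simp_all add: act_mult act_one)

lemma AE_act: "g \<in> carrier \<Gamma> \<Longrightarrow> (AE x in X. P x) \<Longrightarrow> AE x in X. P (act g x)"
  using AE_distrD[OF act_measurable, of g P] by (simp only: distr_act)

lemma target_measurable [measurable]: "target G \<in> count_space (carrier \<Gamma>) \<Otimes>\<^sub>M X \<rightarrow>\<^sub>M X"
proof -
  have "(\<lambda>p. act (fst p) (snd p)) \<in> count_space (carrier \<Gamma>) \<Otimes>\<^sub>M X \<rightarrow>\<^sub>M X"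
  proof (rule measurable_compose_countable'[OF _ _ countable_carrier])
    show "(\<lambda>p. act g (snd p)) \<in> count_space (carrier \<Gamma>) \<Otimes>\<^sub>M X \<rightarrow>\<^sub>M X" if "g \<in> carrier \<Gamma>" for g
      using act_measurable[OF that] by measurable
  qed measurable
  then show ?thesis by (simp add: semidirect_def case_prod_beta)
qed

lemma sets_\<nu>[simp, measurable_cong]: "sets \<nu> = sets (count_space (carrier \<Gamma>) \<Otimes>\<^sub>M X)"
  and kernel: "\<kappa> \<in> X \<rightarrow>\<^sub>M prob_algebra (count_space (carrier \<Gamma>) \<Otimes>\<^sub>M X)"
  and disintegration: "\<nu> = distr \<nu> X (target G) \<bind> \<kappa>"
  and kernel_fibre: "AE x in distr \<nu> X (target G). AE p in \<kappa> x. target G p = x"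
  using class_measure unfolding symmetric_class_measure_def semidirect_simps by blast+

lemma prob_kernel: "x \<in> space X \<Longrightarrow> prob_space (\<kappa> x)"
  and sets_kernel': "x \<in> space X \<Longrightarrow> sets (\<kappa> x) = sets (count_space (carrier \<Gamma>) \<Otimes>\<^sub>M X)"
  using measurable_space[OF kernel] by (auto simp: space_prob_algebra)

text \<open>\<open>\<nu>\<close> has the same null sets as the product of counting measure and
  \<open>X\<close>, and there a set is null exactly when all its slices over the discrete coordinate
  are.\<close>

lemma emeasure_arrows_eq_0_iff:
  assumes A: "A \<in> sets (count_space (carrier \<Gamma>) \<Otimes>\<^sub>M X)"
  shows "emeasure \<nu> A = 0 \<longleftrightarrow> (\<forall>g\<in>carrier \<Gamma>. emeasure X (Pair g -` A) = 0)"
proof -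
  have "absolutely_continuous (arrows G) \<nu>" "absolutely_continuous \<nu> (arrows G)"
    using class_measure unfolding symmetric_class_measure_def by blast+
  then have "null_sets \<nu> = null_sets (count_space (carrier \<Gamma>) \<Otimes>\<^sub>M X)"
    unfolding absolutely_continuous_def by (intro antisym) simp_all
  then have "emeasure \<nu> A = 0 \<longleftrightarrow> emeasure (count_space (carrier \<Gamma>) \<Otimes>\<^sub>M X) A = 0"
    using A by (auto simp: set_eq_iff null_sets_def)
  also have "\<dots> \<longleftrightarrow> (\<integral>\<^sup>+g. emeasure X (Pair g -` A) \<partial>count_space (carrier \<Gamma>)) = 0"
    using A by (subst X.emeasure_pair_measure_alt) auto
  also have "\<dots> \<longleftrightarrow> (\<forall>g\<in>carrier \<Gamma>. emeasure X (Pair g -` A) = 0)"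
    by (subst nn_integral_0_iff_AE) (auto simp: AE_count_space)
  finally show ?thesis .
qed

lemma emeasure_act_vimage:
  assumes "g \<in> carrier \<Gamma>" "A \<in> sets X"
  shows "emeasure X (act g -` A \<inter> space X) = emeasure X A"
  using emeasure_distr[OF act_measurable[OF assms(1)] assms(2)] by (simp add: distr_act assms)

abbreviation "\<mu> \<equiv> distr \<nu> X (target G)"

text \<open>The slice at \<open>g\<close> of the preimage of \<open>A\<close> under the target map
  is a translate of \<open>A\<close>. So the image measure on the base may differ from
  \<open>X\<close>, but statements that hold almost everywhere can be read in
  \<open>X\<close>.\<close>

lemma null_sets_\<mu>: "null_sets \<mu> = null_sets X"
proof -
  have "emeasure \<mu> A = 0 \<longleftrightarrow> emeasure X A = 0" if A[measurable]: "A \<in> sets X" for A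
  proof -
    let ?V = "target G -` A \<inter> space (count_space (carrier \<Gamma>) \<Otimes>\<^sub>M X)"
    have V: "?V \<in> sets (count_space (carrier \<Gamma>) \<Otimes>\<^sub>M X)" by measurable
    have "emeasure \<mu> A = emeasure \<nu> ?V"
      using sets_eq_imp_space_eq[OF sets_\<nu>] by (subst emeasure_distr) auto
    also have "\<dots> = 0 \<longleftrightarrow> (\<forall>g\<in>carrier \<Gamma>. emeasure X (Pair g -` ?V) = 0)"
      by (rule emeasure_arrows_eq_0_iff[OF V])
    also have "\<dots> \<longleftrightarrow> (\<forall>g\<in>carrier \<Gamma>. emeasure X (act g -` A \<inter> space X) = 0)"
      by (intro ball_cong refl arg_cong[where f = "\<lambda>B. emeasure X B = 0"]) (auto simp: space_pair_measure)
    also have "\<dots> \<longleftrightarrow> emeasure X A = 0"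
      \<comment> \<open>All translates have the measure of \<open>A\<close>; the unit supplies one
        of them, so that the quantifier is not vacuous.\<close>
      using one_closed by (auto simp: emeasure_act_vimage)
    finally show ?thesis .
  qed
  then show ?thesis by (auto simp: null_sets_def)
qed

lemma AE_\<mu>_iff: "(AE x in \<mu>. P x) \<longleftrightarrow> (AE x in X. P x)"
  by (simp add: eventually_ae_filter null_sets_\<mu>)

text \<open>Let \<open>A\<close> consist of the \<open>x\<close> whose fibre measure misses the
  label \<open>g\<close>. The set \<open>V\<close> of arrows labelled \<open>g\<close> with target
  in \<open>A\<close> is \<open>\<nu>\<close>-null by disintegration: over \<open>A\<close> by the
  choice of \<open>A\<close>, elsewhere because \<open>\<kappa> x\<close> lives on arrows with
  target \<open>x\<close>. Its slice at \<open>g\<close> is a translate of \<open>A\<close>, so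
  \<open>A\<close> is null.\<close>

lemma emeasure_kernel_atom:
  assumes g: "g \<in> carrier \<Gamma>"
  shows "AE x in X. emeasure (\<kappa> x) ({g} \<times> space X) \<noteq> 0"
proof -
  let ?B = "{g} \<times> space X"
  have B[measurable]: "?B \<in> sets (count_space (carrier \<Gamma>) \<Otimes>\<^sub>M X)" using g by auto
  have em[measurable]: "(\<lambda>x. emeasure (\<kappa> x) A) \<in> borel_measurable X"
    if "A \<in> sets (count_space (carrier \<Gamma>) \<Otimes>\<^sub>M X)" for A
    by (rule measurable_emeasure_kernel[OF measurable_prob_algebraD[OF kernel] that])
  define A where "A = {x \<in> space X. emeasure (\<kappa> x) ?B = 0}"
  have A[measurable]: "A \<in> sets X" unfolding A_def using em[OF B] by measurable
  define V where "V = {g} \<times> (act g -` A \<inter> space X)"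
  have V: "V \<in> sets (count_space (carrier \<Gamma>) \<Otimes>\<^sub>M X)"
    unfolding V_def using g measurable_sets[OF act_measurable[OF g] A] by auto
  have "emeasure \<nu> V = emeasure (\<mu> \<bind> \<kappa>) V" using disintegration by simp
  also have "\<dots> = (\<integral>\<^sup>+x. emeasure (\<kappa> x) V \<partial>\<mu>)"
    using kernel by (intro emeasure_bind[OF _ _ V]) (auto simp: X.not_empty intro: measurable_prob_algebraD)
  also have "\<dots> = (\<integral>\<^sup>+x. 0 \<partial>\<mu>)"
  proof (intro nn_integral_cong_AE, use kernel_fibre AE_space in eventually_elim)
    case (elim x)
    then have x: "x \<in> space X" by simp
    show ?case
    proof (cases "x \<in> A")
      case True
      have "emeasure (\<kappa> x) V \<le> emeasure (\<kappa> x) ?B"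
        using sets_kernel'[OF x] B by (intro emeasure_mono) (auto simp: V_def)
      then show ?thesis using True by (simp add: A_def)
    next
      case False
      have "AE p in \<kappa> x. p \<notin> V" using elim(1)
        by eventually_elim (use False in \<open>auto simp: V_def\<close>)
      moreover have "V \<in> sets (\<kappa> x)" using V sets_kernel'[OF x] by simp
      ultimately show ?thesis using AE_iff_null_sets by blast
    qed
  qed
  finally have "emeasure \<nu> V = 0" by simp
  then have "emeasure X (Pair g -` V) = 0" using g by (simp add: emeasure_arrows_eq_0_iff[OF V])
  also have "Pair g -` V = act g -` A \<inter> space X" unfolding V_def by auto
  finally have "emeasure X A = 0" by (simp add: emeasure_act_vimage[OF g A])
  then have "A \<in> null_sets X" by auto
  from AE_not_in[OF this] show ?thesis using AE_space by eventually_elim (auto simp: A_def)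
qed

text \<open>For fixed \<open>x\<close>, these are the \<open>n\<close>-tuples with common target \<open>x\<close>.\<close>

definition tuple_at :: "nat \<Rightarrow> (nat \<Rightarrow> 'g) \<Rightarrow> 'x \<Rightarrow> (nat \<Rightarrow> 'g \<times> 'x)" where
  "tuple_at n g x = (\<lambda>i\<in>{..<n}. (g i, act (inv g i) x))"

abbreviation "gtuples (n::nat) \<equiv> {..<n} \<rightarrow>\<^sub>E carrier \<Gamma>"

abbreviation "arrow_tuples (n::nat) \<equiv> Pi\<^sub>M {..<n} (\<lambda>_. count_space (carrier \<Gamma>) \<Otimes>\<^sub>M X)"

abbreviation "kernel_power (n::nat) x \<equiv> Pi\<^sub>M {..<n} (\<lambda>_. \<kappa> x)"

lemma kernel_power_measurable: "kernel_power n \<in> \<mu> \<rightarrow>\<^sub>M subprob_algebra (arrow_tuples n)"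
  using measurable_PiM_prob_algebra[OF _ kernel, of "{..<n}"] by (auto intro: measurable_prob_algebraD)

lemma sets_kernel_power: "x \<in> space X \<Longrightarrow> sets (kernel_power n x) = sets (arrow_tuples n)"
  using sets_kernel' by (intro sets_PiM_cong) auto

lemma sets_bind_kernel_power [simp, measurable_cong]: "sets (\<mu> \<bind> kernel_power n) = sets (arrow_tuples n)"
  by (rule sets_bind) (simp_all add: sets_kernel_power X.not_empty)

lemma tuples_measurable [measurable]: "tuples G n \<in> sets (arrow_tuples n)"
proof -
  have c: "(\<lambda>p. target G (p i)) \<in> arrow_tuples n \<rightarrow>\<^sub>M X" if "i < n" for i
    using that by (intro measurable_compose[OF _ target_measurable] measurable_component_singleton) auto
  have "Measurable.pred (arrow_tuples n) (\<lambda>p. target G (p i) = target G (p j))" if "i < n" "j < n" for i j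
    using standard c that unfolding standard_probability_space_def
    by (intro standard_borel_measurable_eq[of X]) auto
  then have "{p \<in> space (arrow_tuples n). \<forall>i\<in>{..<n}. \<forall>j\<in>{..<n}. target G (p i) = target G (p j)} \<in> sets (arrow_tuples n)"
    by (intro sets.sets_Collect_finite_All' sets.sets_Collect_finite_All) (auto simp: pred_def)
  also have "{p \<in> space (arrow_tuples n). \<forall>i\<in>{..<n}. \<forall>j\<in>{..<n}. target G (p i) = target G (p j)} = tuples G n"
    by (auto simp: tuples_def space_PiM)
  finally show ?thesis .
qed

lemma AE_kernel_power_target:
  assumes "x \<in> space X" "AE p in \<kappa> x. target G p = x"
  shows "AE p in kernel_power n x. \<forall>i<n. target G (p i) = x"
proof -
  have "AE p in kernel_power n x. \<forall>i\<in>{..<n}. target G (p i) = x"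
    by (intro eventually_ball_finite ballI AE_PiM_component prob_kernel assms) auto
  then show ?thesis by auto
qed

text \<open>An arrow is determined by its group element and its target, since the inverse of the
  group element moves the target back to the source.\<close>

lemma tuple_eq_tuple_at:
  assumes p: "p \<in> {..<n} \<rightarrow>\<^sub>E space (arrows G)" and "\<And>i. i < n \<Longrightarrow> target G (p i) = x"
  shows "p = tuple_at n (\<lambda>i\<in>{..<n}. fst (p i)) x"
proof (rule PiE_ext[OF p])
  show "tuple_at n (\<lambda>i\<in>{..<n}. fst (p i)) x \<in> {..<n} \<rightarrow>\<^sub>E space (arrows G)"
  proof (rule PiE_I)
    fix i assume i: "i \<in> {..<n}"
    then obtain g y where gy: "p i = (g, y)" "g \<in> carrier \<Gamma>" "y \<in> space X"
      using PiE_mem[OF p i] by (auto simp: space_pair_measure)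
    then have "x = act g y" using assms(2)[of i] i by simp
    then show "tuple_at n (\<lambda>i\<in>{..<n}. fst (p i)) x i \<in> space (arrows G)"
      using i gy by (simp add: tuple_at_def space_pair_measure)
  qed (auto simp: tuple_at_def)
  fix i assume i: "i \<in> {..<n}"
  then obtain g y where gy: "p i = (g, y)" "g \<in> carrier \<Gamma>" "y \<in> space X"
    using PiE_mem[OF p i] by (auto simp: space_pair_measure)
  then have "x = act g y" using assms(2)[of i] i by simp
  then show "p i = tuple_at n (\<lambda>i\<in>{..<n}. fst (p i)) x i" using i gy by (simp add: tuple_at_def)
qed

lemma tuple_at_in_tuples:
  assumes "g \<in> gtuples n" "x \<in> space X"
  shows "tuple_at n g x \<in> tuples G n"
proof -
  have "\<And>i. i < n \<Longrightarrow> g i \<in> carrier \<Gamma>" using assms(1) by auto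
  then show ?thesis
    using assms(2) by (auto simp: tuples_def tuple_at_def space_pair_measure act_in_space)
qed

lemma space_arrow_tuples: "space (arrow_tuples n) = {..<n} \<rightarrow>\<^sub>E space (arrows G)"
  by (simp add: space_PiM)

text \<open>The fibre of the target map over \<open>x\<close> is countable, and \<open>\<kappa> x\<close> charges each of its points
  for almost every \<open>x\<close>. So a measurable set of tuples is null iff it
  contains no tuple with common target \<open>x\<close>, for almost every \<open>x\<close>.\<close>

lemma AE_tuple_measure_iff:
  assumes n: "0 < n"
  shows "(AE p in tuple_measure G \<nu> \<kappa> n. P p) \<longleftrightarrow> (\<forall>g\<in>gtuples n. AE x in X. P (tuple_at n g x))"
    (is "?L \<longleftrightarrow> ?R")
proof -
  have L: "?L \<longleftrightarrow> (AE p in \<mu> \<bind> kernel_power n. p \<in> tuples G n \<longrightarrow> P p)"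
    unfolding tuple_measure_def semidirect_simps
    by (rule AE_restrict_space_iff) (use tuples_measurable in auto)
  have fibre: "AE x in X. AE p in \<kappa> x. target G p = x" using kernel_fibre unfolding AE_\<mu>_iff .
  show ?thesis
  proof
    assume ?L
    then obtain N where N: "N \<in> null_sets (\<mu> \<bind> kernel_power n)"
        "{p \<in> space (\<mu> \<bind> kernel_power n). \<not> (p \<in> tuples G n \<longrightarrow> P p)} \<subseteq> N"
      unfolding L by (auto simp: eventually_ae_filter)
    have Ns[measurable]: "N \<in> sets (arrow_tuples n)" using N(1) by auto
    have sp: "space (\<mu> \<bind> kernel_power n) = space (arrow_tuples n)"
      by (rule sets_eq_imp_space_eq) simp
    have "(\<integral>\<^sup>+x. emeasure (kernel_power n x) N \<partial>\<mu>) = emeasure (\<mu> \<bind> kernel_power n) N"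
      by (rule emeasure_bind[symmetric, OF _ kernel_power_measurable Ns]) (simp add: X.not_empty)
    also have "\<dots> = 0" using N(1) by auto
    finally have "AE x in \<mu>. emeasure (kernel_power n x) N = 0"
      by (rule nn_integral_0_iff_AE[OF measurable_emeasure_kernel[OF kernel_power_measurable Ns], THEN iffD1])
    then have null: "AE x in X. emeasure (kernel_power n x) N = 0" unfolding AE_\<mu>_iff .
    show ?R
    proof
      fix g assume g: "g \<in> gtuples n"
      have "AE x in X. \<forall>i\<in>{..<n}. emeasure (\<kappa> x) ({g i} \<times> space X) \<noteq> 0"
        by (intro eventually_ball_finite ballI emeasure_kernel_atom) (use g in auto)
      with null fibre AE_space[of X] show "AE x in X. P (tuple_at n g x)"
      proof eventually_elim
        case (elim x)
        \<comment> \<open>Among tuples with common target \<open>x\<close>, the box \<open>B\<close>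
          contains only \<open>tuple_at n g x\<close>. It has positive measure, so it meets every
          conull set, and this one tuple must avoid \<open>N\<close>.\<close>
        define B where "B = (\<Pi>\<^sub>E i\<in>{..<n}. {g i} \<times> space X)"
        have Bi: "{g i} \<times> space X \<in> sets (\<kappa> x)" if "i < n" for i
        proof -
          have "g i \<in> carrier \<Gamma>" using g that by auto
          then show ?thesis unfolding sets_kernel'[OF elim(3)] by (intro pair_measureI) auto
        qed
        have "emeasure (kernel_power n x) B = (\<Prod>i\<in>{..<n}. emeasure (\<kappa> x) ({g i} \<times> space X))"
          unfolding B_def by (rule emeasure_PiM_prob_space) (auto intro: Bi prob_kernel[OF elim(3)])
        also have "\<dots> \<noteq> 0" using elim(4) by simp
        finally have Bpos: "emeasure (kernel_power n x) B \<noteq> 0" .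
        have B: "B \<in> sets (kernel_power n x)"
          unfolding B_def by (rule sets_PiM_I_finite) (auto intro: Bi)
        have "N \<in> null_sets (kernel_power n x)"
          using elim(1) sets_kernel_power[OF elim(3)] Ns by auto
        from AE_not_in[OF this] AE_kernel_power_target[OF elim(3,2)]
        have ae: "AE p in kernel_power n x. p \<notin> N \<and> (\<forall>i<n. target G (p i) = x)"
          by eventually_elim auto
        obtain p where p: "p \<in> B" "p \<notin> N" "\<forall>i<n. target G (p i) = x"
        proof (rule ccontr)
          assume "\<not> thesis"
          with that have no: "p \<in> B \<Longrightarrow> \<not> (p \<notin> N \<and> (\<forall>i<n. target G (p i) = x))" for p by blast
          from ae have "AE p in kernel_power n x. p \<notin> B"
            by eventually_elim (use no in blast)
          then have "B \<in> null_sets (kernel_power n x)"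
            using B AE_iff_null_sets by blast
          then show False using Bpos by auto
        qed
        have "tuple_at n g x = p"
        proof
          fix i show "tuple_at n g x i = p i"
          proof (cases "i < n")
            case True
            then obtain y where "p i = (g i, y)" "y \<in> space X" using p(1) unfolding B_def by (auto simp: PiE_iff)
            moreover have "g i \<in> carrier \<Gamma>" using g True by auto
            moreover have "target G (p i) = x" using p(3) True by blast
            ultimately show ?thesis using True by (auto simp: tuple_at_def)
          next
            case False
            then show ?thesis using p(1) unfolding B_def tuple_at_def by (auto simp: PiE_iff extensional_def)
          qed
        qed
        then have "tuple_at n g x \<notin> N" using p(2) by simp
        moreover have "tuple_at n g x \<in> tuples G n" using tuple_at_in_tuples[OF g elim(3)] .
        moreover have "tuple_at n g x \<in> space (\<mu> \<bind> kernel_power n)"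
          unfolding sp using sets.sets_into_space[OF tuples_measurable] calculation(2) by blast
        ultimately show ?case using N(2) by blast
      qed
    qed
  next
    assume R: ?R
    have "countable (gtuples n)" by (intro countable_PiE countable_carrier) auto
    then have "AE x in X. \<forall>g\<in>gtuples n. P (tuple_at n g x)" using R by (simp add: AE_ball_countable)
    then obtain N where N: "N \<in> null_sets X" "{x \<in> space X. \<not> (\<forall>g\<in>gtuples n. P (tuple_at n g x))} \<subseteq> N"
      by (auto simp: eventually_ae_filter)
    have [measurable]: "N \<in> sets X" using N(1) by auto
    \<comment> \<open>The base point is read off the arrow with index 0. Here \<open>0 < n\<close>
      matters: an empty tuple has no target.\<close>
    have t0[measurable]: "(\<lambda>p. target G (p 0)) \<in> arrow_tuples n \<rightarrow>\<^sub>M X"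
      using n by (intro measurable_compose[OF _ target_measurable] measurable_component_singleton) auto
    \<comment> \<open>\<open>P\<close> may fail to be measurable. The bind is therefore evaluated on
      the measurable condition that the base point avoids \<open>N\<close>, which implies
      \<open>P\<close> on tuples.\<close>
    have "AE p in \<mu> \<bind> kernel_power n. target G (p 0) \<notin> N"
    proof (subst AE_bind[OF kernel_power_measurable])
      show "Measurable.pred (arrow_tuples n) (\<lambda>p. target G (p 0) \<notin> N)" by measurable
      show "AE x in \<mu>. AE p in kernel_power n x. target G (p 0) \<notin> N"
        unfolding AE_\<mu>_iff using fibre AE_not_in[OF N(1)] AE_space[of X]
      proof eventually_elim
        case (elim x)
        from AE_kernel_power_target[OF elim(3,1)] show ?case
          by eventually_elim (use n elim(2) in auto)
      qed
    qed
    then show ?L unfolding L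
    proof eventually_elim
      case (elim p)
      show ?case
      proof
        assume p: "p \<in> tuples G n"
        let ?x = "target G (p 0)" and ?g = "\<lambda>i\<in>{..<n}. fst (p i)"
        have p': "p \<in> {..<n} \<rightarrow>\<^sub>E space (arrows G)" "\<And>i. i < n \<Longrightarrow> target G (p i) = ?x"
          using p n unfolding tuples_def by blast+
        have x: "?x \<in> space X"
          using PiE_mem[OF p'(1), of 0] n by (auto simp: space_pair_measure act_in_space)
        have g: "?g \<in> gtuples n"
          using PiE_mem[OF p'(1)] by (auto simp: space_pair_measure mem_Times_iff)
        have "?x \<notin> {x \<in> space X. \<not> (\<forall>g\<in>gtuples n. P (tuple_at n g x))}"
          using N(2) elim by (rule contra_subsetD)
        with x have "\<forall>g\<in>gtuples n. P (tuple_at n g ?x)" by simp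
        then have "P (tuple_at n ?g ?x)" using g by (rule bspec)
        then show "P p" by (simp only: tuple_eq_tuple_at[OF p', symmetric])
      qed
    qed
  qed
qed

lemma tuple_at_measurable:
  assumes g: "g \<in> gtuples n"
  shows "tuple_at n g \<in> X \<rightarrow>\<^sub>M tuple_measure G \<nu> \<kappa> n"
  unfolding tuple_measure_def semidirect_simps
proof (rule measurable_restrict_space2)
  show "tuple_at n g \<in> space X \<rightarrow> tuples G n" using tuple_at_in_tuples[OF g] by blast
  have gi: "g i \<in> carrier \<Gamma>" if "i < n" for i using g that by auto
  have "tuple_at n g \<in> X \<rightarrow>\<^sub>M arrow_tuples n"
    unfolding tuple_at_def using gi act_measurable[OF inv_closed[OF gi]]
    by (intro measurable_restrict measurable_Pair) auto
  then show "tuple_at n g \<in> X \<rightarrow>\<^sub>M (\<mu> \<bind> kernel_power n)" by (simp cong: measurable_cong_sets)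
qed

text \<open>Since \<open>\<Gamma>\<close> is countable, the space of tuples is a countable union of
  copies of \<open>X\<close>, one for each group tuple, and the group components of a point tell
  measurably in which copy it lies.\<close>

lemma borel_measurable_tuple_measure_iff:
  fixes f :: "(nat \<Rightarrow> 'g \<times> 'x) \<Rightarrow> real"
  assumes n: "0 < n"
  shows "f \<in> borel_measurable (tuple_measure G \<nu> \<kappa> n) \<longleftrightarrow>
    (\<forall>g\<in>gtuples n. (\<lambda>x. f (tuple_at n g x)) \<in> borel_measurable X)" (is "?L \<longleftrightarrow> ?R")
proof
  assume ?L
  then show ?R using measurable_compose[OF tuple_at_measurable] by blast
next
  assume R: ?R
  let ?M = "restrict_space (arrow_tuples n) (tuples G n)"
  have cntb: "countable (gtuples n)" by (intro countable_PiE countable_carrier) auto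
  have c: "(\<lambda>p. p i) \<in> ?M \<rightarrow>\<^sub>M count_space (carrier \<Gamma>) \<Otimes>\<^sub>M X" if "i < n" for i
    using that by (intro measurable_restrict_space1 measurable_component_singleton) auto
  have meas: "(\<lambda>p. f (tuple_at n (\<lambda>i\<in>{..<n}. fst (p i)) (target G (p 0)))) \<in> borel_measurable ?M"
  proof (rule measurable_compose_countable'[OF _ _ cntb])
    show "(\<lambda>p. f (tuple_at n g (target G (p 0)))) \<in> borel_measurable ?M" if "g \<in> gtuples n" for g
      using R that n by (intro measurable_compose[OF measurable_compose[OF c target_measurable, of 0]]) auto
    show "(\<lambda>p. \<lambda>i\<in>{..<n}. fst (p i)) \<in> ?M \<rightarrow>\<^sub>M count_space (gtuples n)"
      unfolding measurable_count_space_eq_countable[OF cntb]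
    proof (intro conjI ballI)
      show "(\<lambda>p. \<lambda>i\<in>{..<n}. fst (p i)) \<in> space ?M \<rightarrow> gtuples n"
        by (auto simp: space_restrict_space space_arrow_tuples space_pair_measure PiE_iff mem_Times_iff)
      fix g assume g: "g \<in> gtuples n"
      have "Measurable.pred ?M (\<lambda>p. fst (p i) = g i)" if "i < n" for i
      proof -
        have "(\<lambda>p. fst (p i)) \<in> ?M \<rightarrow>\<^sub>M count_space (carrier \<Gamma>)"
          by (rule measurable_compose[OF c[OF that] measurable_fst])
        then show ?thesis by measurable
      qed
      then have "{p \<in> space ?M. \<forall>i\<in>{..<n}. fst (p i) = g i} \<in> sets ?M"
        by (intro sets.sets_Collect_finite_All) (auto simp: pred_def)
      also have "{p \<in> space ?M. \<forall>i\<in>{..<n}. fst (p i) = g i} = (\<lambda>p. \<lambda>i\<in>{..<n}. fst (p i)) -` {g} \<inter> space ?M"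
        using g by (auto simp: fun_eq_iff PiE_iff extensional_def restrict_def)
      finally show "(\<lambda>p. \<lambda>i\<in>{..<n}. fst (p i)) -` {g} \<inter> space ?M \<in> sets ?M" .
    qed
  qed
  have eq: "tuple_at n (\<lambda>i\<in>{..<n}. fst (p i)) (target G (p 0)) = p" if "p \<in> space ?M" for p
  proof (rule tuple_eq_tuple_at[symmetric])
    have p: "p \<in> tuples G n" using that by (simp add: space_restrict_space)
    then show "p \<in> {..<n} \<rightarrow>\<^sub>E space (arrows G)" unfolding tuples_def by blast
    show "target G (p i) = target G (p 0)" if "i < n" for i
      using p that n unfolding tuples_def by blast
  qed
  have "f \<in> borel_measurable ?M \<longleftrightarrow>
      (\<lambda>p. f (tuple_at n (\<lambda>i\<in>{..<n}. fst (p i)) (target G (p 0)))) \<in> borel_measurable ?M"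
    by (rule measurable_cong) (simp only: eq)
  with meas have "f \<in> borel_measurable ?M" by simp
  moreover have "sets (tuple_measure G \<nu> \<kappa> n) = sets ?M"
    unfolding tuple_measure_def semidirect_simps by (intro sets_restrict_space_cong) simp
  ultimately show ?L by (simp cong: measurable_cong_sets)
qed

end

section \<open>Cohomology classes of functions\<close>

lemma bounded_weakstar_functions_simps [simp]:
  "mult (bounded_weakstar_functions G \<nu> \<kappa> n) = (\<lambda>\<phi> \<psi> p. \<phi> p + \<psi> p)"
  "one (bounded_weakstar_functions G \<nu> \<kappa> n) = (\<lambda>_. 0)"
  by (simp_all add: bounded_weakstar_functions_def)

lemma bounded_weakstar_functions_iff:
  "\<phi> \<in> carrier (bounded_weakstar_functions G \<nu> \<kappa> n) \<longleftrightarrow>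
    (\<forall>v. (\<lambda>p. blinfun_apply (\<phi> p) v) \<in> borel_measurable (tuple_measure G \<nu> \<kappa> n)) \<and>
    (\<exists>C. AE p in tuple_measure G \<nu> \<kappa> n. norm (\<phi> p) \<le> C)"
  by (simp add: bounded_weakstar_functions_def)

lemma bounded_weakstar_functions_zero:
  "(\<lambda>_. 0) \<in> carrier (bounded_weakstar_functions G \<nu> \<kappa> n)"
  by (auto simp: bounded_weakstar_functions_iff intro!: exI[of _ 0])

lemma bounded_weakstar_functions_add:
  assumes "\<phi> \<in> carrier (bounded_weakstar_functions G \<nu> \<kappa> n)" "\<psi> \<in> carrier (bounded_weakstar_functions G \<nu> \<kappa> n)"
  shows "(\<lambda>p. \<phi> p + \<psi> p) \<in> carrier (bounded_weakstar_functions G \<nu> \<kappa> n)"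
proof -
  from assms obtain C D where "AE p in tuple_measure G \<nu> \<kappa> n. norm (\<phi> p) \<le> C"
      "AE p in tuple_measure G \<nu> \<kappa> n. norm (\<psi> p) \<le> D"
    unfolding bounded_weakstar_functions_iff by blast
  then have "AE p in tuple_measure G \<nu> \<kappa> n. norm (\<phi> p + \<psi> p) \<le> C + D"
    by eventually_elim (rule norm_triangle_mono)
  moreover have "(\<lambda>p. blinfun_apply (\<phi> p + \<psi> p) v) \<in> borel_measurable (tuple_measure G \<nu> \<kappa> n)" for v
    unfolding blinfun.add_left
    using assms[unfolded bounded_weakstar_functions_iff] by (intro borel_measurable_add) blast+
  ultimately show ?thesis unfolding bounded_weakstar_functions_iff by blast
qed

lemma bounded_weakstar_functions_scaleR:
  assumes "\<phi> \<in> carrier (bounded_weakstar_functions G \<nu> \<kappa> n)"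
  shows "(\<lambda>p. c *\<^sub>R \<phi> p) \<in> carrier (bounded_weakstar_functions G \<nu> \<kappa> n)"
proof -
  from assms obtain C where "AE p in tuple_measure G \<nu> \<kappa> n. norm (\<phi> p) \<le> C"
    unfolding bounded_weakstar_functions_iff by blast
  then have "AE p in tuple_measure G \<nu> \<kappa> n. norm (c *\<^sub>R \<phi> p) \<le> \<bar>c\<bar> * C"
    by eventually_elim (simp add: mult_left_mono)
  moreover have "(\<lambda>p. blinfun_apply (c *\<^sub>R \<phi> p) v) \<in> borel_measurable (tuple_measure G \<nu> \<kappa> n)" for v
    unfolding blinfun.scaleR_left
    using assms[unfolded bounded_weakstar_functions_iff] by (intro borel_measurable_scaleR borel_measurable_const) blast
  ultimately show ?thesis unfolding bounded_weakstar_functions_iff by blast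
qed

lemma bounded_weakstar_functions_uminus:
  assumes "\<phi> \<in> carrier (bounded_weakstar_functions G \<nu> \<kappa> n)"
  shows "(\<lambda>p. - \<phi> p) \<in> carrier (bounded_weakstar_functions G \<nu> \<kappa> n)"
  using bounded_weakstar_functions_scaleR[OF assms, of "- 1"] by simp

lemma bounded_weakstar_functions_sum:
  assumes "finite I" "\<And>i. i \<in> I \<Longrightarrow> \<phi> i \<in> carrier (bounded_weakstar_functions G \<nu> \<kappa> n)"
  shows "(\<lambda>p. \<Sum>i\<in>I. \<phi> i p) \<in> carrier (bounded_weakstar_functions G \<nu> \<kappa> n)"
  using assms
  by (induction I rule: finite_induct)
    (auto intro: bounded_weakstar_functions_zero bounded_weakstar_functions_add)

lemma ae_class_eq:
  assumes \<phi>: "\<phi> \<in> carrier (bounded_weakstar_functions G \<nu> \<kappa> n)"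
  shows "ae_class G \<nu> \<kappa> n \<phi> =
    {\<psi> \<in> carrier (bounded_weakstar_functions G \<nu> \<kappa> n). AE p in tuple_measure G \<nu> \<kappa> n. \<psi> p = \<phi> p}"
    (is "_ = ?R")
proof (intro equalityI subsetI)
  fix \<psi> assume "\<psi> \<in> ae_class G \<nu> \<kappa> n \<phi>"
  then obtain h where h: "h \<in> null_functions G \<nu> \<kappa> n" "\<psi> = (\<lambda>p. h p + \<phi> p)"
    by (auto simp: ae_class_def r_coset_def)
  then show "\<psi> \<in> ?R"
    using bounded_weakstar_functions_add[OF _ \<phi>, of h] by (auto simp: null_functions_def)
next
  fix \<psi> assume \<psi>: "\<psi> \<in> ?R"
  let ?h = "\<lambda>p. \<psi> p + - \<phi> p"
  have "?h \<in> null_functions G \<nu> \<kappa> n"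
    using \<psi> bounded_weakstar_functions_add[OF _ bounded_weakstar_functions_uminus[OF \<phi>], of \<psi>]
    by (auto simp: null_functions_def)
  moreover have "\<psi> = (\<lambda>p. ?h p + \<phi> p)" by simp
  ultimately show "\<psi> \<in> ae_class G \<nu> \<kappa> n \<phi>"
    unfolding ae_class_def r_coset_def by (intro UN_I[of ?h]) auto
qed

lemma ae_class_eq_iff:
  assumes "\<phi> \<in> carrier (bounded_weakstar_functions G \<nu> \<kappa> n)" "\<psi> \<in> carrier (bounded_weakstar_functions G \<nu> \<kappa> n)"
  shows "ae_class G \<nu> \<kappa> n \<phi> = ae_class G \<nu> \<kappa> n \<psi> \<longleftrightarrow> (AE p in tuple_measure G \<nu> \<kappa> n. \<phi> p = \<psi> p)"
proof
  assume "ae_class G \<nu> \<kappa> n \<phi> = ae_class G \<nu> \<kappa> n \<psi>"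
  moreover have "\<phi> \<in> ae_class G \<nu> \<kappa> n \<phi>" using assms by (simp add: ae_class_eq)
  ultimately show "AE p in tuple_measure G \<nu> \<kappa> n. \<phi> p = \<psi> p" using assms by (simp add: ae_class_eq)
next
  assume *: "AE p in tuple_measure G \<nu> \<kappa> n. \<phi> p = \<psi> p"
  have "(AE p in tuple_measure G \<nu> \<kappa> n. \<zeta> p = \<phi> p) \<longleftrightarrow> (AE p in tuple_measure G \<nu> \<kappa> n. \<zeta> p = \<psi> p)" for \<zeta>
    using * by (intro eventually_cong) auto
  then show "ae_class G \<nu> \<kappa> n \<phi> = ae_class G \<nu> \<kappa> n \<psi>"
    using assms by (simp add: ae_class_eq)
qed

lemma carrier_Linfty:
  "carrier (Linfty G \<nu> \<kappa> n) = ae_class G \<nu> \<kappa> n ` carrier (bounded_weakstar_functions G \<nu> \<kappa> n)"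
  by (auto simp: Linfty_def FactGroup_def RCOSETS_def ae_class_def)

lemma one_Linfty: "one (Linfty G \<nu> \<kappa> n) = ae_class G \<nu> \<kappa> n (\<lambda>_. 0)"
  by (subst ae_class_eq[OF bounded_weakstar_functions_zero])
    (simp add: Linfty_def null_functions_def)

text \<open>The product in the quotient is the set of all sums of representatives; a function in the
  class of the sum splits as \<open>\<phi>\<close> plus the rest, which is almost everywhere
  \<open>\<psi>\<close>.\<close>

lemma mult_Linfty:
  assumes "\<phi> \<in> carrier (bounded_weakstar_functions G \<nu> \<kappa> n)" "\<psi> \<in> carrier (bounded_weakstar_functions G \<nu> \<kappa> n)"
  shows "mult (Linfty G \<nu> \<kappa> n) (ae_class G \<nu> \<kappa> n \<phi>) (ae_class G \<nu> \<kappa> n \<psi>) =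
    ae_class G \<nu> \<kappa> n (\<lambda>p. \<phi> p + \<psi> p)" (is "?L = ?R")
proof -
  note add = bounded_weakstar_functions_add[OF assms]
  have L: "?L = {\<zeta>. \<exists>\<phi>'\<in>ae_class G \<nu> \<kappa> n \<phi>. \<exists>\<psi>'\<in>ae_class G \<nu> \<kappa> n \<psi>. \<zeta> = (\<lambda>p. \<phi>' p + \<psi>' p)}"
    by (auto simp: Linfty_def FactGroup_def set_mult_def)
  show ?thesis
  proof (intro equalityI subsetI)
    fix \<zeta> assume "\<zeta> \<in> ?L"
    then obtain \<phi>' \<psi>' where *: "\<phi>' \<in> ae_class G \<nu> \<kappa> n \<phi>" "\<psi>' \<in> ae_class G \<nu> \<kappa> n \<psi>" "\<zeta> = (\<lambda>p. \<phi>' p + \<psi>' p)"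
      unfolding L by blast
    then have "AE p in tuple_measure G \<nu> \<kappa> n. \<phi>' p = \<phi> p" "AE p in tuple_measure G \<nu> \<kappa> n. \<psi>' p = \<psi> p"
      using assms by (auto simp: ae_class_eq)
    then have "AE p in tuple_measure G \<nu> \<kappa> n. \<zeta> p = \<phi> p + \<psi> p"
      unfolding *(3) by eventually_elim simp
    then show "\<zeta> \<in> ?R"
      using * assms bounded_weakstar_functions_add[of \<phi>' G \<nu> \<kappa> n \<psi>'] add by (simp add: ae_class_eq)
  next
    fix \<zeta> assume "\<zeta> \<in> ?R"
    then have \<zeta>: "\<zeta> \<in> carrier (bounded_weakstar_functions G \<nu> \<kappa> n)" "AE p in tuple_measure G \<nu> \<kappa> n. \<zeta> p = \<phi> p + \<psi> p"
      using add by (auto simp: ae_class_eq)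
    let ?\<psi>' = "\<lambda>p. \<zeta> p + - \<phi> p"
    have "AE p in tuple_measure G \<nu> \<kappa> n. ?\<psi>' p = \<psi> p" using \<zeta>(2) by eventually_elim simp
    then have "?\<psi>' \<in> ae_class G \<nu> \<kappa> n \<psi>"
      using \<zeta>(1) assms bounded_weakstar_functions_add[OF \<zeta>(1) bounded_weakstar_functions_uminus[OF assms(1)]]
      by (simp add: ae_class_eq)
    moreover have "\<phi> \<in> ae_class G \<nu> \<kappa> n \<phi>" using assms by (simp add: ae_class_eq)
    moreover have "\<zeta> = (\<lambda>p. \<phi> p + ?\<psi>' p)" by simp
    ultimately show "\<zeta> \<in> ?L" unfolding L by (intro CollectI bexI[of _ \<phi>] bexI[of _ ?\<psi>'])
  qed
qed

lemma coboundary_function_add: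
  "coboundary_function k (\<lambda>p. \<phi> p + \<psi> p) = (\<lambda>p. coboundary_function k \<phi> p + coboundary_function k \<psi> p)"
  by (simp add: coboundary_function_def fun_eq_iff scaleR_right_distrib sum.distrib)

lemma coboundary_function_uminus:
  "coboundary_function k (\<lambda>p. - \<phi> p) = (\<lambda>p. - coboundary_function k \<phi> p)"
  by (simp add: coboundary_function_def fun_eq_iff sum_negf)

lemma coboundary_function_zero: "coboundary_function k (\<lambda>_. 0) = (\<lambda>_. 0)"
  by (simp add: coboundary_function_def fun_eq_iff)

text \<open>Representatives of the elements of \<open>cochains\<close>. The analysis is done on
  functions and almost everywhere equality, and returns to classes only at the end.\<close>

definition bounded_cochains ::
  "('a, 'x) measured_groupoid \<Rightarrow> 'a measure \<Rightarrow> ('x \<Rightarrow> 'a measure) \<Rightarrow>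
   ('a \<Rightarrow> ('b::banach \<Rightarrow>\<^sub>L real) \<Rightarrow> ('b \<Rightarrow>\<^sub>L real)) \<Rightarrow> nat \<Rightarrow> ((nat \<Rightarrow> 'a) \<Rightarrow> ('b \<Rightarrow>\<^sub>L real)) set" where
  "bounded_cochains G \<nu> \<kappa> L k =
    {\<phi> \<in> carrier (bounded_weakstar_functions G \<nu> \<kappa> (Suc k)). invariant_function G \<nu> \<kappa> L (Suc k) \<phi>}"

section \<open>Cochains in the coordinates group tuple and base point\<close>

context semidirect_groupoid begin

lemma bounded_weakstar_functions_coordinates:
  assumes "0 < n"
  shows "\<phi> \<in> carrier (bounded_weakstar_functions G \<nu> \<kappa> n) \<longleftrightarrow>
    (\<forall>v. \<forall>g\<in>gtuples n. (\<lambda>x. blinfun_apply (\<phi> (tuple_at n g x)) v) \<in> borel_measurable X) \<and>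
    (\<exists>C. \<forall>g\<in>gtuples n. AE x in X. norm (\<phi> (tuple_at n g x)) \<le> C)"
  unfolding bounded_weakstar_functions_iff borel_measurable_tuple_measure_iff[OF assms]
    AE_tuple_measure_iff[OF assms] ..

lemma weakstar_measurable_tuple_at:
  assumes "0 < n" and "\<phi> \<in> carrier (bounded_weakstar_functions G \<nu> \<kappa> n)" and "g \<in> gtuples n"
  shows "(\<lambda>x. blinfun_apply (\<phi> (tuple_at n g x)) v) \<in> borel_measurable X"
  using assms(2)[unfolded bounded_weakstar_functions_coordinates[OF assms(1)], THEN conjunct1, rule_format, OF assms(3)] .

lemma bounded_tuple_at:
  assumes "0 < n" and "\<phi> \<in> carrier (bounded_weakstar_functions G \<nu> \<kappa> n)"
  obtains C where "\<forall>g\<in>gtuples n. AE x in X. norm (\<phi> (tuple_at n g x)) \<le> C"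
  using assms(2)[unfolded bounded_weakstar_functions_coordinates[OF assms(1)], THEN conjunct2] ..

definition translate :: "nat \<Rightarrow> 'g \<Rightarrow> (nat \<Rightarrow> 'g) \<Rightarrow> (nat \<Rightarrow> 'g)" where
  "translate n h g = (\<lambda>i\<in>{..<n}. h \<otimes> g i)"

lemma translate_closed: "h \<in> carrier \<Gamma> \<Longrightarrow> g \<in> gtuples n \<Longrightarrow> translate n h g \<in> gtuples n"
  by (auto simp: translate_def)

text \<open>The acting arrow is \<open>(h, act (inv h) x)\<close>, with target \<open>x\<close>. Its
  inverse carries the arrow with group element \<open>g i\<close> and target \<open>x\<close> to the
  one with group element \<open>inv h \<otimes> g i\<close> and target \<open>act (inv h) x\<close>.
  So the group tuple is translated and the base point moves along.\<close>

lemma invariant_function_coordinates: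
  assumes "0 < n"
  shows "invariant_function G \<nu> \<kappa> L n \<phi> \<longleftrightarrow>
    (\<forall>h\<in>carrier \<Gamma>. \<forall>g\<in>gtuples n. AE x in X.
      L (h, act (inv h) x) (\<phi> (tuple_at n (translate n (inv h) g) (act (inv h) x))) = \<phi> (tuple_at n g x))"
    (is "_ \<longleftrightarrow> ?R")
proof -
  let ?P = "\<lambda>q. L (q 0) (\<phi> (\<lambda>i\<in>{..<n}. gmult G (ginv G (q 0)) (q (Suc i)))) = \<phi> (\<lambda>i\<in>{..<n}. q (Suc i))"
  have I: "invariant_function G \<nu> \<kappa> L n \<phi> \<longleftrightarrow> (\<forall>g\<in>gtuples (Suc n). AE x in X. ?P (tuple_at (Suc n) g x))"
    unfolding invariant_function_def by (rule AE_tuple_measure_iff) simp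
  \<comment> \<open>\<open>cons h g\<close> puts the acting arrow at index 0, the place that
    \<open>invariant_function\<close> gives it.\<close>
  define cons where "cons h g = (\<lambda>i\<in>{..<Suc n}. case i of 0 \<Rightarrow> h | Suc j \<Rightarrow> g j)" for h :: 'g and g
  have cons: "cons h g \<in> gtuples (Suc n)" if "h \<in> carrier \<Gamma>" "g \<in> gtuples n" for h g
  proof (rule PiE_I)
    fix i assume "i \<in> {..<Suc n}"
    then show "cons h g i \<in> carrier \<Gamma>"
      using that(1) PiE_mem[OF that(2)] by (cases i) (simp_all add: cons_def)
  qed (simp add: cons_def)
  have P: "?P (tuple_at (Suc n) (cons h g) x) \<longleftrightarrow>
      L (h, act (inv h) x) (\<phi> (tuple_at n (translate n (inv h) g) (act (inv h) x))) = \<phi> (tuple_at n g x)"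
    if h: "h \<in> carrier \<Gamma>" and g: "g \<in> gtuples n" and x: "x \<in> space X" for h g x
  proof -
    let ?q = "tuple_at (Suc n) (cons h g) x"
    have gi: "g i \<in> carrier \<Gamma>" if "i < n" for i using g that by auto
    have q0: "?q 0 = (h, act (inv h) x)" by (simp add: tuple_at_def cons_def)
    have qS: "?q (Suc i) = (g i, act (inv (g i)) x)" if "i < n" for i
      using that by (simp add: tuple_at_def cons_def)
    have "(\<lambda>i\<in>{..<n}. gmult G (ginv G (?q 0)) (?q (Suc i))) = tuple_at n (translate n (inv h) g) (act (inv h) x)"
      unfolding tuple_at_def[of n] q0
    proof (rule restrict_ext)
      fix i assume "i \<in> {..<n}"
      then show "gmult G (ginv G (h, act (inv h) x)) (?q (Suc i)) =
          (translate n (inv h) g i, act (inv (translate n (inv h) g i)) (act (inv h) x))"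
        using h x gi[of i]
        by (simp add: qS translate_def act_mult inv_mult_group m_assoc)
    qed
    moreover have "(\<lambda>i\<in>{..<n}. ?q (Suc i)) = tuple_at n g x"
      unfolding tuple_at_def[of n] by (rule restrict_ext) (simp add: qS)
    ultimately show ?thesis by (simp only: q0)
  qed
  show ?thesis
  proof
    assume inv: "invariant_function G \<nu> \<kappa> L n \<phi>"
    show ?R
    proof (intro ballI)
      fix h g assume hg: "h \<in> carrier \<Gamma>" "g \<in> gtuples n"
      have "AE x in X. ?P (tuple_at (Suc n) (cons h g) x)" using inv cons[OF hg] unfolding I by blast
      with AE_space show "AE x in X. L (h, act (inv h) x) (\<phi> (tuple_at n (translate n (inv h) g) (act (inv h) x))) = \<phi> (tuple_at n g x)"
        by eventually_elim (simp only: P[OF hg])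
    qed
  next
    assume R: ?R
    show "invariant_function G \<nu> \<kappa> L n \<phi>" unfolding I
    proof
      fix k assume k: "k \<in> gtuples (Suc n)"
      define h where "h = k 0"
      define g where "g = (\<lambda>i\<in>{..<n}. k (Suc i))"
      have hg: "h \<in> carrier \<Gamma>" "g \<in> gtuples n" using k by (auto simp: h_def g_def)
      have kc: "k = cons h g"
      proof
        fix i show "k i = cons h g i"
          using k by (cases i) (auto simp: cons_def h_def g_def PiE_iff extensional_def)
      qed
      have "AE x in X. L (h, act (inv h) x) (\<phi> (tuple_at n (translate n (inv h) g) (act (inv h) x))) = \<phi> (tuple_at n g x)"
        using R hg by blast
      with AE_space show "AE x in X. ?P (tuple_at (Suc n) k x)"
        unfolding kc by eventually_elim (simp only: P[OF hg])
    qed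
  qed
qed

text \<open>The shift of the base point by \<open>inv h\<close> preserves null sets. As a result one
  invariant representative suffices, although \<open>cochains\<close> asks for invariance of all of
  them.\<close>

lemma invariant_function_cong:
  assumes "0 < n" and eq: "AE p in tuple_measure G \<nu> \<kappa> n. \<phi> p = \<psi> p" and inv: "invariant_function G \<nu> \<kappa> L n \<phi>"
  shows "invariant_function G \<nu> \<kappa> L n \<psi>"
  unfolding invariant_function_coordinates[OF assms(1)]
proof (intro ballI)
  fix h g assume hg: "h \<in> carrier \<Gamma>" "g \<in> gtuples n"
  have e: "AE x in X. \<phi> (tuple_at n g' x) = \<psi> (tuple_at n g' x)" if "g' \<in> gtuples n" for g'
    using eq that unfolding AE_tuple_measure_iff[OF assms(1)] by blast
  have hi: "inv h \<in> carrier \<Gamma>" using hg by simp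
  have "AE x in X. L (h, act (inv h) x) (\<phi> (tuple_at n (translate n (inv h) g) (act (inv h) x))) = \<phi> (tuple_at n g x)"
    using inv hg unfolding invariant_function_coordinates[OF assms(1)] by blast
  with e[OF hg(2)] AE_act[OF hi e[OF translate_closed[OF hi hg(2)]]]
  show "AE x in X. L (h, act (inv h) x) (\<psi> (tuple_at n (translate n (inv h) g) (act (inv h) x))) = \<psi> (tuple_at n g x)"
    by eventually_elim simp
qed

lemma omit_closed: "g \<in> gtuples (k + 2) \<Longrightarrow> omit (k + 1) i g \<in> gtuples (k + 1)"
  by (auto simp: omit_def PiE_iff)

text \<open>Omitting an arrow leaves the base point in place. The coboundary is thus a finite
  alternating sum over group tuples at a fixed point, a form that is compatible with linear
  averaging over the points.\<close>

lemma omit_tuple_at: "omit (k + 1) i (tuple_at (k + 2) g x) = tuple_at (k + 1) (omit (k + 1) i g) x"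
  by (auto simp: omit_def tuple_at_def fun_eq_iff restrict_def)

lemma coboundary_function_tuple_at:
  "coboundary_function k \<phi> (tuple_at (k + 2) g x) =
    (\<Sum>i<k + 2. (-1) ^ i *\<^sub>R \<phi> (tuple_at (k + 1) (omit (k + 1) i g) x))"
  unfolding coboundary_function_def omit_tuple_at ..

lemma coboundary_function_closed:
  assumes \<phi>: "\<phi> \<in> carrier (bounded_weakstar_functions G \<nu> \<kappa> (k + 1))"
  shows "coboundary_function k \<phi> \<in> carrier (bounded_weakstar_functions G \<nu> \<kappa> (k + 2))"
proof -
  have "(\<lambda>p. \<Sum>i\<in>{..<k + 2}. (-1) ^ i *\<^sub>R \<phi> (omit (k + 1) i p)) \<in> carrier (bounded_weakstar_functions G \<nu> \<kappa> (k + 2))"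
  proof (intro bounded_weakstar_functions_sum bounded_weakstar_functions_scaleR)
    fix i
    have k1: "0 < k + 1" and k2: "0 < k + 2" by simp_all
    obtain C where C: "\<forall>g\<in>gtuples (k + 1). AE x in X. norm (\<phi> (tuple_at (k + 1) g x)) \<le> C"
      using bounded_tuple_at[OF k1 \<phi>] .
    show "(\<lambda>p. \<phi> (omit (k + 1) i p)) \<in> carrier (bounded_weakstar_functions G \<nu> \<kappa> (k + 2))"
      unfolding bounded_weakstar_functions_coordinates[of "k + 2", OF k2] omit_tuple_at
    proof (intro conjI allI ballI exI[of _ C])
      fix g assume "g \<in> gtuples (k + 2)"
      then have g: "omit (k + 1) i g \<in> gtuples (k + 1)" by (rule omit_closed)
      show "(\<lambda>x. blinfun_apply (\<phi> (tuple_at (k + 1) (omit (k + 1) i g) x)) v) \<in> borel_measurable X" for v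
        by (rule weakstar_measurable_tuple_at[OF k1 \<phi> g])
      show "AE x in X. norm (\<phi> (tuple_at (k + 1) (omit (k + 1) i g) x)) \<le> C" using C g by (rule bspec)
    qed
  qed simp
  then show ?thesis by (simp add: coboundary_function_def[abs_def])
qed

lemma coboundary_function_cong:
  assumes "AE p in tuple_measure G \<nu> \<kappa> (k + 1). \<phi> p = \<psi> p"
  shows "AE p in tuple_measure G \<nu> \<kappa> (k + 2). coboundary_function k \<phi> p = coboundary_function k \<psi> p"
proof (subst AE_tuple_measure_iff)
  have e: "AE x in X. \<phi> (tuple_at (k + 1) g x) = \<psi> (tuple_at (k + 1) g x)" if "g \<in> gtuples (k + 1)" for g
    using assms that by (subst (asm) AE_tuple_measure_iff) auto
  show "\<forall>g\<in>gtuples (k + 2). AE x in X.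
      coboundary_function k \<phi> (tuple_at (k + 2) g x) = coboundary_function k \<psi> (tuple_at (k + 2) g x)"
  proof
    fix g assume g: "g \<in> gtuples (k + 2)"
    have "AE x in X. \<forall>i\<in>{..<k + 2}. \<phi> (tuple_at (k + 1) (omit (k + 1) i g) x) = \<psi> (tuple_at (k + 1) (omit (k + 1) i g) x)"
      by (intro eventually_ball_finite ballI e omit_closed g) simp
    then show "AE x in X. coboundary_function k \<phi> (tuple_at (k + 2) g x) = coboundary_function k \<psi> (tuple_at (k + 2) g x)"
      unfolding coboundary_function_tuple_at by eventually_elim simp
  qed
qed simp

lemma coboundary_ae_class:
  assumes \<phi>: "\<phi> \<in> carrier (bounded_weakstar_functions G \<nu> \<kappa> (k + 1))"
  shows "coboundary G \<nu> \<kappa> k (ae_class G \<nu> \<kappa> (k + 1) \<phi>) = ae_class G \<nu> \<kappa> (k + 2) (coboundary_function k \<phi>)"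
proof -
  have "ae_class G \<nu> \<kappa> (k + 2) (coboundary_function k \<psi>) = ae_class G \<nu> \<kappa> (k + 2) (coboundary_function k \<phi>)"
    if "\<psi> \<in> ae_class G \<nu> \<kappa> (k + 1) \<phi>" for \<psi>
    using that \<phi> unfolding ae_class_eq[OF \<phi>]
    by (subst ae_class_eq_iff) (auto intro!: coboundary_function_closed[simplified] coboundary_function_cong[simplified])
  moreover have "\<phi> \<in> ae_class G \<nu> \<kappa> (k + 1) \<phi>" using \<phi> by (subst ae_class_eq[OF \<phi>]) auto
  ultimately show ?thesis unfolding coboundary_def by blast
qed

end

section \<open>Cohomology classes as cosets of functions\<close>

locale semidirect_action = semidirect_groupoid \<Gamma> X act \<nu> \<kappa>
  for \<Gamma> :: "'g monoid" (structure) and X :: "'x measure" and act and \<nu> and \<kappa> +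
  fixes L :: "'g \<times> 'x \<Rightarrow> ('b::banach \<Rightarrow>\<^sub>L real) \<Rightarrow> ('b \<Rightarrow>\<^sub>L real)"
  assumes L_add: "L p (\<phi> + \<psi>) = L p \<phi> + L p \<psi>"
begin

text \<open>The letter does not stand for cocycles: \<open>Z k\<close> holds all bounded invariant
  functions of \<open>k + 1\<close> arrows, and cocycles are cut out by a further condition.\<close>

abbreviation "Z \<equiv> bounded_cochains G \<nu> \<kappa> L"

lemma L_zero: "L p 0 = 0"
  using L_add[of p 0 0] by simp

lemma L_uminus: "L p (- \<phi>) = - L p \<phi>"
  using L_add[of p \<phi> "- \<phi>"] by (simp add: L_zero minus_unique)

lemma bounded_cochains_zero: "(\<lambda>_. 0) \<in> Z k"
  by (simp add: bounded_cochains_def bounded_weakstar_functions_zero invariant_function_def L_zero)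

lemma bounded_cochains_uminus: "\<phi> \<in> Z k \<Longrightarrow> (\<lambda>p. - \<phi> p) \<in> Z k"
  by (simp add: bounded_cochains_def bounded_weakstar_functions_uminus invariant_function_def L_uminus)

lemma bounded_cochains_add:
  assumes "\<phi> \<in> Z k" "\<psi> \<in> Z k"
  shows "(\<lambda>p. \<phi> p + \<psi> p) \<in> Z k"
proof -
  have "invariant_function G \<nu> \<kappa> L (Suc k) \<phi>" "invariant_function G \<nu> \<kappa> L (Suc k) \<psi>"
    using assms by (auto simp: bounded_cochains_def)
  then have "invariant_function G \<nu> \<kappa> L (Suc k) (\<lambda>p. \<phi> p + \<psi> p)"
    unfolding invariant_function_def by eventually_elim (simp add: L_add)
  then show ?thesis using assms
    by (simp add: bounded_cochains_def bounded_weakstar_functions_add)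
qed

lemma cochains_eq: "cochains G \<nu> \<kappa> L k = ae_class G \<nu> \<kappa> (Suc k) ` Z k"
proof -
  have "(\<forall>\<psi>\<in>ae_class G \<nu> \<kappa> (Suc k) \<phi>. invariant_function G \<nu> \<kappa> L (Suc k) \<psi>) \<longleftrightarrow>
      invariant_function G \<nu> \<kappa> L (Suc k) \<phi>"
    if \<phi>: "\<phi> \<in> carrier (bounded_weakstar_functions G \<nu> \<kappa> (Suc k))" for \<phi>
    unfolding ae_class_eq[OF \<phi>]
    using \<phi> by (auto intro: invariant_function_cong[rotated -1] simp: eq_commute)
  then show ?thesis
    unfolding cochains_def carrier_Linfty bounded_cochains_def by blast
qed

text \<open>For a cocycle \<open>\<phi>\<close> of degree \<open>m + 1\<close>, hence a function of \<open>m + 2\<close> arrows, this is its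
  cohomology class.\<close>

definition coset :: "nat \<Rightarrow> ((nat \<Rightarrow> 'g \<times> 'x) \<Rightarrow> 'b \<Rightarrow>\<^sub>L real) \<Rightarrow> ((nat \<Rightarrow> 'g \<times> 'x) \<Rightarrow> 'b \<Rightarrow>\<^sub>L real) set set" where
  "coset m \<phi> = coboundaries G \<nu> \<kappa> L (Suc m) #>\<^bsub>cocycles G \<nu> \<kappa> L (Suc m)\<^esub> ae_class G \<nu> \<kappa> (m + 2) \<phi>"

lemma coboundaries_eq:
  "coboundaries G \<nu> \<kappa> L (Suc m) = (\<lambda>\<beta>. ae_class G \<nu> \<kappa> (m + 2) (coboundary_function m \<beta>)) ` Z m"
proof -
  have "coboundary G \<nu> \<kappa> m (ae_class G \<nu> \<kappa> (Suc m) \<beta>) = ae_class G \<nu> \<kappa> (m + 2) (coboundary_function m \<beta>)"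
    if "\<beta> \<in> Z m" for \<beta>
    using that coboundary_ae_class[of \<beta> m] by (simp add: bounded_cochains_def)
  then show ?thesis by (simp add: coboundaries_def cochains_eq image_image cong: image_cong)
qed

lemma carrier_cocycles_eq:
  "carrier (cocycles G \<nu> \<kappa> L k) = ae_class G \<nu> \<kappa> (Suc k) `
    {\<phi> \<in> Z k. AE p in tuple_measure G \<nu> \<kappa> (k + 2). coboundary_function k \<phi> p = 0}"
proof -
  have "coboundary G \<nu> \<kappa> k (ae_class G \<nu> \<kappa> (Suc k) \<phi>) = one (Linfty G \<nu> \<kappa> (k + 2)) \<longleftrightarrow>
      (AE p in tuple_measure G \<nu> \<kappa> (k + 2). coboundary_function k \<phi> p = 0)" if "\<phi> \<in> Z k" for \<phi>
  proof -
    have \<phi>: "\<phi> \<in> carrier (bounded_weakstar_functions G \<nu> \<kappa> (k + 1))" using that by (simp add: bounded_cochains_def)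
    show ?thesis
      using coboundary_ae_class[OF \<phi>]
        ae_class_eq_iff[OF coboundary_function_closed[OF \<phi>] bounded_weakstar_functions_zero]
      by (simp add: one_Linfty)
  qed
  then show ?thesis by (auto simp: cocycles_def cochains_eq)
qed

lemma coset_eq:
  assumes \<phi>: "\<phi> \<in> carrier (bounded_weakstar_functions G \<nu> \<kappa> (m + 2))"
  shows "coset m \<phi> = (\<lambda>\<beta>. ae_class G \<nu> \<kappa> (m + 2) (\<lambda>p. coboundary_function m \<beta> p + \<phi> p)) ` Z m"
proof -
  have "mult (Linfty G \<nu> \<kappa> (m + 2)) (ae_class G \<nu> \<kappa> (m + 2) (coboundary_function m \<beta>)) (ae_class G \<nu> \<kappa> (m + 2) \<phi>) =
      ae_class G \<nu> \<kappa> (m + 2) (\<lambda>p. coboundary_function m \<beta> p + \<phi> p)" if "\<beta> \<in> Z m" for \<beta>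
    using that by (intro mult_Linfty coboundary_function_closed \<phi>) (simp add: bounded_cochains_def)
  then show ?thesis
    by (auto simp: coset_def r_coset_def coboundaries_eq cocycles_def)
qed

text \<open>If the cosets agree, the representative with primitive 0 yields \<open>\<beta>\<close>.
  Conversely, shifting primitives by \<open>\<beta>\<close> gives one inclusion and shifting by its
  negative the other.\<close>

lemma coset_eq_iff:
  assumes \<phi>: "\<phi> \<in> carrier (bounded_weakstar_functions G \<nu> \<kappa> (m + 2))"
    and \<psi>: "\<psi> \<in> carrier (bounded_weakstar_functions G \<nu> \<kappa> (m + 2))"
  shows "coset m \<phi> = coset m \<psi> \<longleftrightarrow>
    (\<exists>\<beta>\<in>Z m. AE p in tuple_measure G \<nu> \<kappa> (m + 2). \<phi> p = coboundary_function m \<beta> p + \<psi> p)"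
proof -
  have cl: "(\<lambda>p. coboundary_function m \<beta> p + \<zeta> p) \<in> carrier (bounded_weakstar_functions G \<nu> \<kappa> (m + 2))"
    if "\<beta> \<in> Z m" "\<zeta> \<in> carrier (bounded_weakstar_functions G \<nu> \<kappa> (m + 2))" for \<beta> \<zeta>
    using that by (intro bounded_weakstar_functions_add coboundary_function_closed) (auto simp: bounded_cochains_def)
  have sub: "coset m \<phi> \<subseteq> coset m \<psi>"
    if \<phi>: "\<phi> \<in> carrier (bounded_weakstar_functions G \<nu> \<kappa> (m + 2))"
      and \<psi>: "\<psi> \<in> carrier (bounded_weakstar_functions G \<nu> \<kappa> (m + 2))"
      and \<beta>: "\<beta> \<in> Z m" and eq: "AE p in tuple_measure G \<nu> \<kappa> (m + 2). \<phi> p = coboundary_function m \<beta> p + \<psi> p"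
    for \<phi> \<psi> \<beta>
    unfolding coset_eq[OF \<phi>] coset_eq[OF \<psi>]
  proof
    fix A assume "A \<in> (\<lambda>\<beta>. ae_class G \<nu> \<kappa> (m + 2) (\<lambda>p. coboundary_function m \<beta> p + \<phi> p)) ` Z m"
    then obtain \<gamma> where \<gamma>: "\<gamma> \<in> Z m" "A = ae_class G \<nu> \<kappa> (m + 2) (\<lambda>p. coboundary_function m \<gamma> p + \<phi> p)" by blast
    have \<gamma>\<beta>: "(\<lambda>p. \<gamma> p + \<beta> p) \<in> Z m" by (rule bounded_cochains_add[OF \<gamma>(1) \<beta>])
    have "A = ae_class G \<nu> \<kappa> (m + 2) (\<lambda>p. coboundary_function m (\<lambda>p. \<gamma> p + \<beta> p) p + \<psi> p)"
      unfolding \<gamma>(2) ae_class_eq_iff[OF cl[OF \<gamma>(1) \<phi>] cl[OF \<gamma>\<beta> \<psi>]]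
      using eq by eventually_elim (simp add: coboundary_function_add)
    then show "A \<in> (\<lambda>\<beta>. ae_class G \<nu> \<kappa> (m + 2) (\<lambda>p. coboundary_function m \<beta> p + \<psi> p)) ` Z m"
      using \<gamma>\<beta> by blast
  qed
  show ?thesis
  proof
    assume eq: "coset m \<phi> = coset m \<psi>"
    have "ae_class G \<nu> \<kappa> (m + 2) (\<lambda>p. coboundary_function m (\<lambda>_. 0) p + \<phi> p) \<in> coset m \<phi>"
      unfolding coset_eq[OF \<phi>] using bounded_cochains_zero by blast
    then obtain \<beta> where \<beta>: "\<beta> \<in> Z m"
        "ae_class G \<nu> \<kappa> (m + 2) \<phi> = ae_class G \<nu> \<kappa> (m + 2) (\<lambda>p. coboundary_function m \<beta> p + \<psi> p)"
      unfolding eq coset_eq[OF \<psi>] by (auto simp: coboundary_function_zero)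
    then show "\<exists>\<beta>\<in>Z m. AE p in tuple_measure G \<nu> \<kappa> (m + 2). \<phi> p = coboundary_function m \<beta> p + \<psi> p"
      using ae_class_eq_iff[OF \<phi> cl[OF \<beta>(1) \<psi>]] by blast
  next
    assume "\<exists>\<beta>\<in>Z m. AE p in tuple_measure G \<nu> \<kappa> (m + 2). \<phi> p = coboundary_function m \<beta> p + \<psi> p"
    then obtain \<beta> where \<beta>: "\<beta> \<in> Z m" "AE p in tuple_measure G \<nu> \<kappa> (m + 2). \<phi> p = coboundary_function m \<beta> p + \<psi> p"
      by blast
    have "AE p in tuple_measure G \<nu> \<kappa> (m + 2). \<psi> p = coboundary_function m (\<lambda>p. - \<beta> p) p + \<phi> p"
      using \<beta>(2) by eventually_elim (simp add: coboundary_function_uminus)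
    from sub[OF \<phi> \<psi> \<beta>] sub[OF \<psi> \<phi> bounded_cochains_uminus[OF \<beta>(1)] this]
    show "coset m \<phi> = coset m \<psi>" by blast
  qed
qed

text \<open>The index \<open>m\<close> is the degree of the primitives, so a class of degree
  \<open>Suc m\<close> is represented by functions of \<open>m + 2\<close> arrows.\<close>

lemma carrier_Hmb_eq:
  "carrier (Hmb G \<nu> \<kappa> L (Suc m)) = coset m `
    {\<phi> \<in> Z (Suc m). AE p in tuple_measure G \<nu> \<kappa> (m + 3). coboundary_function (Suc m) \<phi> p = 0}"
proof -
  have m: "Suc m + 2 = m + 3" "Suc (Suc m) = m + 2" by simp_all
  have "carrier (Hmb G \<nu> \<kappa> L (Suc m)) = (\<lambda>A. coboundaries G \<nu> \<kappa> L (Suc m) #>\<^bsub>cocycles G \<nu> \<kappa> L (Suc m)\<^esub> A) ` carrier (cocycles G \<nu> \<kappa> L (Suc m))"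
    unfolding Hmb_def FactGroup_def RCOSETS_def by auto
  also have "\<dots> = coset m ` {\<phi> \<in> Z (Suc m). AE p in tuple_measure G \<nu> \<kappa> (m + 3). coboundary_function (Suc m) \<phi> p = 0}"
    unfolding carrier_cocycles_eq image_image coset_def m ..
  finally show ?thesis .
qed

end

section \<open>Pullback along a factor map\<close>

lemma (in semidirect_groupoid) measure_preserving_act:
  "g \<in> carrier \<Gamma> \<Longrightarrow> measure_preserving_map X X (act g)"
  by unfold_locales (auto simp: distr_act X.prob_space_axioms)

lemma pullback_function_add:
  "pullback_function f n (\<lambda>p. \<phi> p + \<psi> p) = (\<lambda>p. pullback_function f n \<phi> p + pullback_function f n \<psi> p)"
  by (simp add: pullback_function_def fun_eq_iff)

lemma pullback_coboundary_function:
  "pullback_function f (k + 2) (coboundary_function k \<phi>) = coboundary_function k (pullback_function f (k + 1) \<phi>)"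
proof
  fix p
  have "omit (k + 1) i (\<lambda>j\<in>{..<k + 2}. f (p j)) = (\<lambda>j\<in>{..<k + 1}. f (omit (k + 1) i p j))" for i
    by (auto simp: omit_def fun_eq_iff restrict_def)
  then show "pullback_function f (k + 2) (coboundary_function k \<phi>) p = coboundary_function k (pullback_function f (k + 1) \<phi>) p"
    unfolding pullback_function_def coboundary_function_def by simp
qed

locale semidirect_factor =
  GX: semidirect_groupoid \<Gamma> X actX \<nu>G \<kappa>G + GY: semidirect_groupoid \<Gamma> Y actY \<nu>H \<kappa>H
  for \<Gamma> :: "'g monoid" (structure) and X :: "'x measure" and actX and \<nu>G and \<kappa>G
    and Y :: "'y measure" and actY and \<nu>H and \<kappa>H +
  fixes T :: "'x \<Rightarrow> 'y" and Lflat :: "'g \<times> 'y \<Rightarrow> 'b::{banach, second_countable_topology} \<Rightarrow>\<^sub>L 'b"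
  assumes factor: "factor_map \<Gamma> X actX Y actY T"
    and module: "coefficient_module (semidirect \<Gamma> Y actY) \<nu>H \<kappa>H Lflat"
begin

abbreviation "L \<equiv> contragredient GY.G Lflat"

sublocale T: measure_preserving_map X Y T
  using factor unfolding factor_map_def by unfold_locales (auto simp: GX.X.prob_space_axioms)

sublocale AY: semidirect_action \<Gamma> Y actY \<nu>H \<kappa>H L
  by unfold_locales (simp add: contragredient_def bounded_bilinear.add_left[OF bounded_bilinear_blinfun_compose])

text \<open>The same coefficients seen from \<open>X\<close>. The operators depend on a point of
  \<open>X\<close> only through its image under \<open>T\<close>, which lets them pass through
  averages over the fibres of \<open>T\<close>.\<close>

sublocale AX: semidirect_action \<Gamma> X actX \<nu>G \<kappa>G "\<lambda>p. L (semidirect_map T p)"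
  by unfold_locales (simp add: contragredient_def bounded_bilinear.add_left[OF bounded_bilinear_blinfun_compose])

lemma semidirect_map_apply: "semidirect_map T (g, x) = (g, T x)"
  by (simp add: semidirect_map_def)

lemma T_in_space: "x \<in> space X \<Longrightarrow> T x \<in> space Y"
  by (rule measurable_space[OF T.T])

lemma T_act: "g \<in> carrier \<Gamma> \<Longrightarrow> x \<in> space X \<Longrightarrow> T (actX g x) = actY g (T x)"
  using factor unfolding factor_map_def by blast

lemma L_apply:
  "g \<in> carrier \<Gamma> \<Longrightarrow> y \<in> space Y \<Longrightarrow> L (g, actY (inv g) y) \<psi> = \<psi> o\<^sub>L Lflat (inv g, y)"
  by (simp add: contragredient_def)

lemma Lflat_norm: "g \<in> carrier \<Gamma> \<Longrightarrow> y \<in> space Y \<Longrightarrow> norm (Lflat (g, y) v) = norm v"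
  using module unfolding coefficient_module_def by (auto simp: space_pair_measure)

lemma Lflat_measurable:
  assumes "g \<in> carrier \<Gamma>"
  shows "(\<lambda>y. Lflat (g, y) v) \<in> borel_measurable Y"
proof -
  have "(\<lambda>p. Lflat p v) \<in> borel_measurable (count_space (carrier \<Gamma>) \<Otimes>\<^sub>M Y)"
    using module unfolding coefficient_module_def by simp
  moreover have "Pair g \<in> Y \<rightarrow>\<^sub>M count_space (carrier \<Gamma>) \<Otimes>\<^sub>M Y" using assms by simp
  ultimately show ?thesis by (rule measurable_compose[rotated])
qed

text \<open>Equivariance of \<open>T\<close> sends the arrow into \<open>x\<close> with group
  element \<open>g i\<close> to the arrow into \<open>T x\<close> with the same group element. In
  coordinates the pullback is composition with \<open>T\<close> at a fixed group tuple.\<close>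

lemma pullback_function_tuple_at:
  assumes "g \<in> GX.gtuples n" "x \<in> space X"
  shows "pullback_function (semidirect_map T) n \<phi> (GX.tuple_at n g x) = \<phi> (GY.tuple_at n g (T x))"
proof -
  have "(\<lambda>i\<in>{..<n}. semidirect_map T (GX.tuple_at n g x i)) = GY.tuple_at n g (T x)"
    unfolding GY.tuple_at_def
  proof (rule restrict_ext)
    fix i assume i: "i \<in> {..<n}"
    then have "g i \<in> carrier \<Gamma>" using assms(1) by (rule PiE_mem[rotated])
    then show "semidirect_map T (GX.tuple_at n g x i) = (g i, actY (inv g i) (T x))"
      using i assms(2) by (simp add: GX.tuple_at_def semidirect_map_def T_act)
  qed
  then show ?thesis by (simp add: pullback_function_def)
qed

lemma AE_pullback:
  assumes "0 < n" "AE p in tuple_measure GY.G \<nu>H \<kappa>H n. \<phi> p = \<psi> p"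
  shows "AE p in tuple_measure GX.G \<nu>G \<kappa>G n.
    pullback_function (semidirect_map T) n \<phi> p = pullback_function (semidirect_map T) n \<psi> p"
  unfolding GX.AE_tuple_measure_iff[OF assms(1)]
proof
  fix g assume g: "g \<in> GX.gtuples n"
  then have "AE y in Y. \<phi> (GY.tuple_at n g y) = \<psi> (GY.tuple_at n g y)"
    using assms(2) unfolding GY.AE_tuple_measure_iff[OF assms(1)] by blast
  from T.AE_preimage[OF this] AE_space[of X]
  show "AE x in X. pullback_function (semidirect_map T) n \<phi> (GX.tuple_at n g x) =
      pullback_function (semidirect_map T) n \<psi> (GX.tuple_at n g x)"
    by eventually_elim (simp add: pullback_function_tuple_at[OF g])
qed

lemma pullback_function_closed:
  fixes \<phi> :: "_ \<Rightarrow> 'b \<Rightarrow>\<^sub>L real"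
  assumes n: "0 < n" and \<phi>: "\<phi> \<in> carrier (bounded_weakstar_functions GY.G \<nu>H \<kappa>H n)"
  shows "pullback_function (semidirect_map T) n \<phi> \<in> carrier (bounded_weakstar_functions GX.G \<nu>G \<kappa>G n)"
proof -
  note m = GY.weakstar_measurable_tuple_at[OF n \<phi>]
  obtain C where "\<forall>g\<in>GX.gtuples n. AE y in Y. norm (\<phi> (GY.tuple_at n g y)) \<le> C"
    using GY.bounded_tuple_at[OF n \<phi>] .
  note C = this[rule_format]
  show ?thesis
    unfolding GX.bounded_weakstar_functions_coordinates[OF n]
  proof (intro conjI allI ballI exI[of _ C])
    fix g assume g: "g \<in> GX.gtuples n"
    show "(\<lambda>x. blinfun_apply (pullback_function (semidirect_map T) n \<phi> (GX.tuple_at n g x)) v) \<in> borel_measurable X" for v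
      using measurable_compose[OF T.T m[OF g, of v]]
      by (rule measurable_cong[THEN iffD1, rotated]) (simp add: pullback_function_tuple_at[OF g])
    from T.AE_preimage[OF C[OF g]] AE_space[of X]
    show "AE x in X. norm (pullback_function (semidirect_map T) n \<phi> (GX.tuple_at n g x)) \<le> C"
      by eventually_elim (simp add: pullback_function_tuple_at[OF g])
  qed
qed

lemma pullback_bounded_cochains:
  assumes \<phi>: "\<phi> \<in> AY.Z k"
  shows "pullback_function (semidirect_map T) (Suc k) \<phi> \<in> AX.Z k"
proof -
  let ?n = "Suc k"
  have n: "0 < ?n" by simp
  have inv: "invariant_function GY.G \<nu>H \<kappa>H L ?n \<phi>" using \<phi> by (simp add: bounded_cochains_def)
  have "invariant_function GX.G \<nu>G \<kappa>G (\<lambda>p. L (semidirect_map T p)) ?n (pullback_function (semidirect_map T) ?n \<phi>)"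
    unfolding GX.invariant_function_coordinates[OF n]
  proof (intro ballI)
    fix h g assume hg: "h \<in> carrier \<Gamma>" "g \<in> GX.gtuples ?n"
    have hi: "inv h \<in> carrier \<Gamma>" using hg by simp
    have "AE y in Y. L (h, actY (inv h) y) (\<phi> (GY.tuple_at ?n (GY.translate ?n (inv h) g) (actY (inv h) y))) = \<phi> (GY.tuple_at ?n g y)"
      using inv hg unfolding GY.invariant_function_coordinates[OF n] by blast
    from T.AE_preimage[OF this] AE_space[of X]
    show "AE x in X. L (semidirect_map T (h, actX (inv h) x))
        (pullback_function (semidirect_map T) ?n \<phi> (GX.tuple_at ?n (GX.translate ?n (inv h) g) (actX (inv h) x))) =
        pullback_function (semidirect_map T) ?n \<phi> (GX.tuple_at ?n g x)"
    proof eventually_elim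
      case (elim x)
      then show ?case
        using hi by (simp add: pullback_function_tuple_at[OF hg(2)]
          pullback_function_tuple_at[OF GX.translate_closed[OF hi hg(2)]] GX.act_in_space semidirect_map_apply T_act)
    qed
  qed
  then show ?thesis using pullback_function_closed[OF n, of \<phi>] \<phi> by (simp add: bounded_cochains_def)
qed

lemma pullback_ae_class:
  fixes \<phi> :: "_ \<Rightarrow> 'b \<Rightarrow>\<^sub>L real"
  assumes n: "0 < n" and \<phi>: "\<phi> \<in> carrier (bounded_weakstar_functions GY.G \<nu>H \<kappa>H n)"
  shows "pullback GX.G \<nu>G \<kappa>G (semidirect_map T) n (ae_class GY.G \<nu>H \<kappa>H n \<phi>) =
    ae_class GX.G \<nu>G \<kappa>G n (pullback_function (semidirect_map T) n \<phi>)"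
proof -
  have "ae_class GX.G \<nu>G \<kappa>G n (pullback_function (semidirect_map T) n \<psi>) =
      ae_class GX.G \<nu>G \<kappa>G n (pullback_function (semidirect_map T) n \<phi>)"
    if "\<psi> \<in> ae_class GY.G \<nu>H \<kappa>H n \<phi>" for \<psi>
  proof -
    from that have \<psi>: "\<psi> \<in> carrier (bounded_weakstar_functions GY.G \<nu>H \<kappa>H n)"
        "AE p in tuple_measure GY.G \<nu>H \<kappa>H n. \<psi> p = \<phi> p"
      by (simp_all add: ae_class_eq[OF \<phi>])
    show ?thesis
      using AE_pullback[OF n \<psi>(2)]
      by (subst ae_class_eq_iff[OF pullback_function_closed[OF n \<psi>(1)] pullback_function_closed[OF n \<phi>]])
  qed
  moreover have "\<phi> \<in> ae_class GY.G \<nu>H \<kappa>H n \<phi>" using \<phi> by (simp add: ae_class_eq[OF \<phi>])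
  ultimately show ?thesis unfolding pullback_def by blast
qed

text \<open>Changing a representative by the coboundary of \<open>\<beta>\<close> changes its
  pullback by the coboundary of the pullback of \<open>\<beta>\<close>, so all members of the union
  in \<open>Hmb_map\<close> give the same coset.\<close>

lemma Hmb_map_coset:
  assumes \<phi>: "\<phi> \<in> carrier (bounded_weakstar_functions GY.G \<nu>H \<kappa>H (m + 2))"
  shows "Hmb_map GX.G \<nu>G \<kappa>G (semidirect_map T) L (Suc m) (AY.coset m \<phi>) =
    AX.coset m (pullback_function (semidirect_map T) (m + 2) \<phi>)"
proof -
  let ?pb = "pullback_function (semidirect_map T)"
  have n: "0 < m + 2" "Suc m + 1 = m + 2" by simp_all
  have "coboundaries GX.G \<nu>G \<kappa>G (\<lambda>g. L (semidirect_map T g)) (Suc m)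
        #>\<^bsub>cocycles GX.G \<nu>G \<kappa>G (\<lambda>g. L (semidirect_map T g)) (Suc m)\<^esub> pullback GX.G \<nu>G \<kappa>G (semidirect_map T) (Suc m + 1) A
      = AX.coset m (?pb (m + 2) \<phi>)" if "A \<in> AY.coset m \<phi>" for A
  proof -
    from that obtain \<beta> where \<beta>: "\<beta> \<in> AY.Z m"
        "A = ae_class GY.G \<nu>H \<kappa>H (m + 2) (\<lambda>p. coboundary_function m \<beta> p + \<phi> p)"
      unfolding AY.coset_eq[OF \<phi>] by blast
    have cl: "(\<lambda>p. coboundary_function m \<beta> p + \<phi> p) \<in> carrier (bounded_weakstar_functions GY.G \<nu>H \<kappa>H (m + 2))"
      using \<beta>(1) by (intro bounded_weakstar_functions_add GY.coboundary_function_closed \<phi>) (simp add: bounded_cochains_def)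
    have "AX.coset m (?pb (m + 2) (\<lambda>p. coboundary_function m \<beta> p + \<phi> p)) = AX.coset m (?pb (m + 2) \<phi>)"
      unfolding AX.coset_eq_iff[OF pullback_function_closed[OF n(1) cl] pullback_function_closed[OF n(1) \<phi>]]
    proof (rule bexI)
      show "?pb (Suc m) \<beta> \<in> AX.Z m" by (rule pullback_bounded_cochains[OF \<beta>(1)])
      show "AE p in tuple_measure GX.G \<nu>G \<kappa>G (m + 2). ?pb (m + 2) (\<lambda>p. coboundary_function m \<beta> p + \<phi> p) p =
          coboundary_function m (?pb (Suc m) \<beta>) p + ?pb (m + 2) \<phi> p"
        unfolding pullback_function_add pullback_coboundary_function by simp
    qed
    then show ?thesis unfolding n(2) \<beta>(2) pullback_ae_class[OF n(1) cl] AX.coset_def .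
  qed
  \<comment> \<open>A union over an empty class would be empty; the primitive 0 provides a
    member.\<close>
  moreover have "AY.coset m \<phi> \<noteq> {}" unfolding AY.coset_eq[OF \<phi>] using AY.bounded_cochains_zero by blast
  ultimately show ?thesis unfolding Hmb_map_def by blast
qed

text \<open>\<open>\<beta>\<close> and \<open>\<beta>'\<close> stand for a cochain at a group tuple
  and at its translate by \<open>inv h\<close>; the relation assumed between them is invariance in
  coordinates, and it passes to their conditional expectations. After pairing with a test function,
  it results from changes of variables by \<open>inv h\<close> on \<open>Y\<close> and on
  \<open>X\<close>, which \<open>T\<close> intertwines.\<close>

lemma cond_exp_translate:
  assumes h: "h \<in> carrier \<Gamma>"
    and \<beta>m: "\<And>v. (\<lambda>x. blinfun_apply (\<beta> x) v) \<in> borel_measurable X" and \<beta>b: "AE x in X. norm (\<beta> x) \<le> C"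
    and \<beta>m': "\<And>v. (\<lambda>x. blinfun_apply (\<beta>' x) v) \<in> borel_measurable X" and \<beta>b': "AE x in X. norm (\<beta>' x) \<le> C"
    and inv: "AE x in X. \<beta>' (actX (inv h) x) o\<^sub>L Lflat (inv h, T x) = \<beta> x"
    and F: "\<And>v. (\<lambda>y. blinfun_apply (F y) v) \<in> borel_measurable Y" "\<And>y. norm (F y) \<le> C" "T.weakstar_cond_exp \<beta> F"
    and F': "\<And>v. (\<lambda>y. blinfun_apply (F' y) v) \<in> borel_measurable Y" "\<And>y. norm (F' y) \<le> C" "T.weakstar_cond_exp \<beta>' F'"
  shows "AE y in Y. F' (actY (inv h) y) o\<^sub>L Lflat (inv h, y) = F y"
proof -
  have hi: "inv h \<in> carrier \<Gamma>" using h by simp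
  have C0: "0 \<le> C" using F(2) norm_ge_zero order_trans by blast
  interpret aX: measure_preserving_map X X "actX (inv h)" by (rule GX.measure_preserving_act[OF hi])
  interpret aY: measure_preserving_map Y Y "actY (inv h)" by (rule GY.measure_preserving_act[OF hi])
  interpret aY': measure_preserving_map Y Y "actY h" by (rule GY.measure_preserving_act[OF h])
  have Fa: "(\<lambda>y. F' (actY (inv h) y) v) \<in> borel_measurable Y" for v
    using measurable_compose[OF aY.T F'(1)] .
  show ?thesis
  proof (rule T.AE_eq_of_integral_apply_eq)
    show "(\<lambda>y. (F' (actY (inv h) y) o\<^sub>L Lflat (inv h, y)) v) \<in> borel_measurable Y" for v
      using borel_measurable_weakstar_apply[OF Fa Lflat_measurable[OF hi]] by simp
    show "AE y in Y. norm (F' (actY (inv h) y) o\<^sub>L Lflat (inv h, y)) \<le> C"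
    proof (rule AE_I2)
      fix y assume y: "y \<in> space Y"
      have "norm (F' (actY (inv h) y) o\<^sub>L Lflat (inv h, y)) \<le> norm (F' (actY (inv h) y)) * norm (Lflat (inv h, y))"
        by (rule norm_blinfun_compose)
      also have "\<dots> \<le> C * 1"
        by (intro mult_mono F'(2) norm_blinfun_bound C0) (simp_all add: Lflat_norm[OF hi y])
      finally show "norm (F' (actY (inv h) y) o\<^sub>L Lflat (inv h, y)) \<le> C" by simp
    qed
    show "(\<lambda>y. F y v) \<in> borel_measurable Y" for v by (rule F(1))
    show "AE y in Y. norm (F y) \<le> C" using F(2) by simp
    fix A v assume A[measurable]: "A \<in> sets Y"
    define w where "w y = indicator A y *\<^sub>R (v :: 'b)" for y
    have w: "integrable Y w"
      unfolding w_def by (rule GY.X.integrable_const_bound[of _ "norm v"]) (auto simp: indicator_def)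
    \<comment> \<open>\<open>u0\<close> absorbs the operator into the test function, and
      \<open>u\<close> is chosen so that \<open>u (actY (inv h) y) = u0 y\<close>. Thus
      \<open>F'\<close> at the translated point is paired with \<open>u\<close> at that same
      point.\<close>
    define u0 where "u0 y = Lflat (inv h, y) (w y)" for y
    define u where "u z = u0 (actY h z)" for z
    have "u0 = (\<lambda>y. indicator A y *\<^sub>R Lflat (inv h, y) v)" by (simp add: u0_def w_def blinfun.scaleR_right fun_eq_iff)
    then have u0m: "u0 \<in> borel_measurable Y" using Lflat_measurable[OF hi] by simp
    have u0: "integrable Y u0"
      by (rule Bochner_Integration.integrable_bound[OF w u0m]) (auto simp: u0_def Lflat_norm[OF hi])
    have u: "integrable Y u" unfolding u_def by (rule aY'.integrable_preimage[OF u0])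
    have ua: "u (actY (inv h) y) = u0 y" if "y \<in> space Y" for y using that h by (simp add: u_def)
    have "(\<integral>y. (F' (actY (inv h) y) o\<^sub>L Lflat (inv h, y)) (w y) \<partial>Y) = (\<integral>y. F' (actY (inv h) y) (u (actY (inv h) y)) \<partial>Y)"
      by (intro Bochner_Integration.integral_cong refl) (simp add: ua u0_def)
    also have "\<dots> = (\<integral>y. F' y (u y) \<partial>Y)"
      by (rule aY.integral_preimage[OF borel_measurable_weakstar_apply[OF F'(1) borel_measurable_integrable[OF u]]])
    also have "\<dots> = (\<integral>x. \<beta>' x (u (T x)) \<partial>X)"
      using F'(3) u by (simp add: T.weakstar_cond_exp_def)
    also have "\<dots> = (\<integral>x. \<beta>' (actX (inv h) x) (u (T (actX (inv h) x))) \<partial>X)"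
      by (rule aX.integral_preimage[symmetric, OF borel_measurable_weakstar_apply[OF \<beta>m'
            measurable_compose[OF T.T borel_measurable_integrable[OF u]]]])
    also have "\<dots> = (\<integral>x. \<beta> x (w (T x)) \<partial>X)"
    proof (rule integral_cong_AE)
      have "(\<lambda>x. \<beta>' x (u (T x))) \<in> borel_measurable X"
        using borel_measurable_weakstar_apply[OF \<beta>m' measurable_compose[OF T.T borel_measurable_integrable[OF u]]] .
      from measurable_compose[OF aX.T this]
      show "(\<lambda>x. \<beta>' (actX (inv h) x) (u (T (actX (inv h) x)))) \<in> borel_measurable X" .
      show "(\<lambda>x. \<beta> x (w (T x))) \<in> borel_measurable X"
        using borel_measurable_weakstar_apply[OF \<beta>m measurable_compose[OF T.T borel_measurable_integrable[OF w]]] .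
      show "AE x in X. \<beta>' (actX (inv h) x) (u (T (actX (inv h) x))) = \<beta> x (w (T x))"
        using inv AE_space[of X]
      proof eventually_elim
        case (elim x)
        have "u (T (actX (inv h) x)) = Lflat (inv h, T x) (w (T x))"
          using elim(2) by (simp add: T_act[OF hi] ua T_in_space u0_def)
        then show ?case by (simp flip: elim(1))
      qed
    qed
    also have "\<dots> = (\<integral>y. F y (w y) \<partial>Y)"
      using F(3) w by (simp add: T.weakstar_cond_exp_def)
    finally show "(\<integral>y. (F' (actY (inv h) y) o\<^sub>L Lflat (inv h, y)) (indicator A y *\<^sub>R v) \<partial>Y) = (\<integral>y. F y (indicator A y *\<^sub>R v) \<partial>Y)"
      unfolding w_def .
  qed
qed

text \<open>The primitive on \<open>Y\<close> is the conditional expectation of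
  \<open>\<beta>\<close>, taken separately at each group tuple. Two cochains \<open>\<phi>\<close>
  and \<open>\<psi>\<close> are kept instead of their difference, to match
  \<open>coset_eq_iff\<close>.\<close>

lemma descend_primitive:
  assumes \<beta>: "\<beta> \<in> AX.Z m"
    and \<phi>: "\<phi> \<in> carrier (bounded_weakstar_functions GY.G \<nu>H \<kappa>H (m + 2))"
    and \<psi>: "\<psi> \<in> carrier (bounded_weakstar_functions GY.G \<nu>H \<kappa>H (m + 2))"
    and eq: "AE p in tuple_measure GX.G \<nu>G \<kappa>G (m + 2).
      pullback_function (semidirect_map T) (m + 2) \<phi> p =
      coboundary_function m \<beta> p + pullback_function (semidirect_map T) (m + 2) \<psi> p"
  obtains b where "b \<in> AY.Z m" "AE p in tuple_measure GY.G \<nu>H \<kappa>H (m + 2). \<phi> p = coboundary_function m b p + \<psi> p"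
proof -
  let ?n = "m + 1"
  have n: "0 < ?n" "0 < m + 2" by simp_all
  have \<beta>': "\<beta> \<in> carrier (bounded_weakstar_functions GX.G \<nu>G \<kappa>G ?n)"
      "invariant_function GX.G \<nu>G \<kappa>G (\<lambda>p. L (semidirect_map T p)) ?n \<beta>"
    using \<beta> by (simp_all add: bounded_cochains_def)
  note \<beta>m = GX.weakstar_measurable_tuple_at[OF n(1) \<beta>'(1)]
  obtain C0 where "\<forall>g\<in>GX.gtuples ?n. AE x in X. norm (\<beta> (GX.tuple_at ?n g x)) \<le> C0"
    using GX.bounded_tuple_at[OF n(1) \<beta>'(1)] .
  note C0 = this[rule_format]
  \<comment> \<open>\<open>C0\<close> bounds all group tuples at once, and \<open>b\<close> inherits
    the bound \<open>C\<close>. The absolute value supplies the nonnegativity that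
    \<open>weakstar_cond_exp_exists\<close> asks for.\<close>
  define C where "C = \<bar>C0\<bar>"
  have C: "0 \<le> C" unfolding C_def by simp
  have \<beta>b: "AE x in X. norm (\<beta> (GX.tuple_at ?n g x)) \<le> C" if "g \<in> GX.gtuples ?n" for g
    using C0[OF that] by eventually_elim (simp add: C_def)
  define P where "P g F \<longleftrightarrow> (\<forall>v. (\<lambda>y. blinfun_apply (F y) v) \<in> borel_measurable Y) \<and> (\<forall>y. norm (F y) \<le> C) \<and>
    T.weakstar_cond_exp (\<lambda>x. \<beta> (GX.tuple_at ?n g x)) F" for g and F :: "'y \<Rightarrow> 'b \<Rightarrow>\<^sub>L real"
  have "\<exists>F. P g F" if "g \<in> GX.gtuples ?n" for g
    unfolding P_def by (rule T.weakstar_cond_exp_exists[OF \<beta>m[OF that] \<beta>b[OF that] C]) blast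
  then obtain F where "\<And>g. g \<in> GX.gtuples ?n \<Longrightarrow> P g (F g)" by metis
  then have F: "\<And>g v. g \<in> GX.gtuples ?n \<Longrightarrow> (\<lambda>y. blinfun_apply (F g y) v) \<in> borel_measurable Y"
      "\<And>g y. g \<in> GX.gtuples ?n \<Longrightarrow> norm (F g y) \<le> C"
      "\<And>g. g \<in> GX.gtuples ?n \<Longrightarrow> T.weakstar_cond_exp (\<lambda>x. \<beta> (GX.tuple_at ?n g x)) (F g)"
    unfolding P_def by blast+
  \<comment> \<open>This undoes \<open>tuple_at\<close>: the group components select the function,
    and the target of the arrow with index 0 is the base point.\<close>
  define b where "b p = F (\<lambda>i\<in>{..<?n}. fst (p i)) (target GY.G (p 0))" for p
  have b: "b (GY.tuple_at ?n g y) = F g y" if g: "g \<in> GX.gtuples ?n" and y: "y \<in> space Y" for g y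
  proof -
    have "(\<lambda>i\<in>{..<?n}. fst (GY.tuple_at ?n g y i)) = g"
      using g by (auto simp: GY.tuple_at_def fun_eq_iff restrict_def PiE_iff extensional_def)
    moreover have "g 0 \<in> carrier \<Gamma>" using PiE_mem[OF g, of 0] by simp
    then have "target GY.G (GY.tuple_at ?n g y 0) = y"
      using y by (simp add: GY.tuple_at_def)
    ultimately show ?thesis unfolding b_def by simp
  qed
  have b_closed: "b \<in> carrier (bounded_weakstar_functions GY.G \<nu>H \<kappa>H ?n)"
    unfolding GY.bounded_weakstar_functions_coordinates[OF n(1)]
  proof (intro conjI allI ballI exI[of _ C])
    fix g assume g: "g \<in> GX.gtuples ?n"
    show "(\<lambda>y. blinfun_apply (b (GY.tuple_at ?n g y)) v) \<in> borel_measurable Y" for v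
      using F(1)[OF g, of v] by (rule measurable_cong[THEN iffD1, rotated]) (simp only: b[OF g])
    show "AE y in Y. norm (b (GY.tuple_at ?n g y)) \<le> C"
      by (rule AE_I2) (simp only: b[OF g] F(2)[OF g])
  qed
  have b_inv: "invariant_function GY.G \<nu>H \<kappa>H L ?n b"
    unfolding GY.invariant_function_coordinates[OF n(1)]
  proof (intro ballI)
    fix h g assume h: "h \<in> carrier \<Gamma>" and g: "g \<in> GX.gtuples ?n"
    let ?g' = "GY.translate ?n (inv h) g"
    have hi: "inv h \<in> carrier \<Gamma>" using h by simp
    have g': "?g' \<in> GX.gtuples ?n" by (rule GY.translate_closed[OF hi g])
    have "AE x in X. L (semidirect_map T (h, actX (inv h) x)) (\<beta> (GX.tuple_at ?n ?g' (actX (inv h) x))) = \<beta> (GX.tuple_at ?n g x)"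
      using \<beta>'(2) h g unfolding GX.invariant_function_coordinates[OF n(1)] by blast
    then have "AE x in X. \<beta> (GX.tuple_at ?n ?g' (actX (inv h) x)) o\<^sub>L Lflat (inv h, T x) = \<beta> (GX.tuple_at ?n g x)"
      using AE_space[of X]
      by eventually_elim (simp add: semidirect_map_apply T_act[OF hi] L_apply[OF h T_in_space])
    from cond_exp_translate[OF h \<beta>m[OF g] \<beta>b[OF g] \<beta>m[OF g'] \<beta>b[OF g'] this F[OF g] F[OF g']]
    have "AE y in Y. F ?g' (actY (inv h) y) o\<^sub>L Lflat (inv h, y) = F g y" .
    then show "AE y in Y. L (h, actY (inv h) y) (b (GY.tuple_at ?n ?g' (actY (inv h) y))) = b (GY.tuple_at ?n g y)"
      using AE_space[of Y]
      by eventually_elim (simp only: b[OF g] b[OF g'] GY.act_in_space[OF hi] L_apply[OF h])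
  qed
  have "AE p in tuple_measure GY.G \<nu>H \<kappa>H (m + 2). \<phi> p = coboundary_function m b p + \<psi> p"
    unfolding GY.AE_tuple_measure_iff[OF n(2)]
  proof
    fix g assume g: "g \<in> GX.gtuples (m + 2)"
    let ?o = "\<lambda>i. omit ?n i g"
    have o: "?o i \<in> GX.gtuples ?n" for i by (rule GX.omit_closed[OF g])
    note \<phi>m = GY.weakstar_measurable_tuple_at[OF n(2) \<phi> g] and \<psi>m = GY.weakstar_measurable_tuple_at[OF n(2) \<psi> g]
    obtain D where "\<forall>g\<in>GX.gtuples (m + 2). AE y in Y. norm (\<phi> (GY.tuple_at (m + 2) g y)) \<le> D"
      using GY.bounded_tuple_at[OF n(2) \<phi>] .
    note \<phi>b = this[rule_format, OF g]
    obtain E where "\<forall>g\<in>GX.gtuples (m + 2). AE y in Y. norm (\<psi> (GY.tuple_at (m + 2) g y)) \<le> E"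
      using GY.bounded_tuple_at[OF n(2) \<psi>] .
    note \<psi>b = this[rule_format, OF g]
    \<comment> \<open>The right hand side of the equation in coordinates, with \<open>b\<close>
      replaced by the functions \<open>F\<close> that define it, so that integrals can be
      compared.\<close>
    define S where "S y = (\<Sum>i<m + 2. (-1) ^ i *\<^sub>R F (?o i) y) + \<psi> (GY.tuple_at (m + 2) g y)" for y
    have S_apply: "S y v = (\<Sum>i<m + 2. (-1) ^ i * F (?o i) y v) + \<psi> (GY.tuple_at (m + 2) g y) v" for y v
      by (simp only: S_def blinfun.add_left blinfun.sum_left blinfun.scaleR_left real_scaleR_def)
    have "AE y in Y. \<phi> (GY.tuple_at (m + 2) g y) = S y"
    proof (rule T.AE_eq_of_integral_apply_eq[OF \<phi>m \<phi>b])
      show "(\<lambda>y. S y v) \<in> borel_measurable Y" for v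
        unfolding S_apply
        by (intro borel_measurable_add borel_measurable_sum borel_measurable_times borel_measurable_const F(1) o \<psi>m)
      show "AE y in Y. norm (S y) \<le> (\<Sum>i<m + 2. C) + E"
        using \<psi>b
      proof eventually_elim
        case (elim y)
        have "norm (\<Sum>i<m + 2. (-1) ^ i *\<^sub>R F (?o i) y) \<le> (\<Sum>i<m + 2. C)"
          by (rule sum_norm_le) (simp only: norm_scaleR power_abs abs_minus_cancel abs_one power_one mult_1 F(2)[OF o])
        then show ?case unfolding S_def using elim by (rule norm_triangle_mono)
      qed
      fix A v assume A[measurable]: "A \<in> sets Y"
      define w where "w y = indicator A y *\<^sub>R (v :: 'b)" for y
      have w: "integrable Y w"
        unfolding w_def by (rule GY.X.integrable_const_bound[of _ "norm v"]) (auto simp: indicator_def)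
      have wT: "integrable X (\<lambda>x. w (T x))" by (rule T.integrable_preimage[OF w])
      have pe: "AE x in X. \<phi> (GY.tuple_at (m + 2) g (T x)) =
          (\<Sum>i<m + 2. (-1) ^ i *\<^sub>R \<beta> (GX.tuple_at ?n (?o i) x)) + \<psi> (GY.tuple_at (m + 2) g (T x))"
      proof -
        have "AE x in X. pullback_function (semidirect_map T) (m + 2) \<phi> (GX.tuple_at (m + 2) g x) =
            coboundary_function m \<beta> (GX.tuple_at (m + 2) g x) + pullback_function (semidirect_map T) (m + 2) \<psi> (GX.tuple_at (m + 2) g x)"
          using eq g unfolding GX.AE_tuple_measure_iff[OF n(2)] by blast
        then show ?thesis using AE_space[of X]
          by eventually_elim (simp only: pullback_function_tuple_at[OF g] GX.coboundary_function_tuple_at)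
      qed
      have iF: "integrable Y (\<lambda>y. F (?o i) y (w y))" for i
        by (rule integrable_weakstar_apply[OF F(1)[OF o] _ w, of _ C]) (rule AE_I2[OF F(2)[OF o]])
      have i\<beta>: "integrable X (\<lambda>x. \<beta> (GX.tuple_at ?n (?o i) x) (w (T x)))" for i
        by (rule integrable_weakstar_apply[OF \<beta>m[OF o] \<beta>b[OF o] wT])
      have i\<psi>: "integrable Y (\<lambda>y. \<psi> (GY.tuple_at (m + 2) g y) (w y))"
        by (rule integrable_weakstar_apply[OF \<psi>m \<psi>b w])
      have i\<phi>: "integrable Y (\<lambda>y. \<phi> (GY.tuple_at (m + 2) g y) (w y))"
        by (rule integrable_weakstar_apply[OF \<phi>m \<phi>b w])
      note i\<psi>T = T.integrable_preimage[OF i\<psi>]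
      \<comment> \<open>\<open>\<phi>\<close> and \<open>\<psi>\<close> are evaluated at
        \<open>T x\<close>, so their integrals move between \<open>Y\<close> and \<open>X\<close> by
        change of variables. The terms in \<open>\<beta>\<close> become terms in \<open>F\<close> by
        the defining property of the conditional expectation.\<close>
      have "(\<integral>y. \<phi> (GY.tuple_at (m + 2) g y) (w y) \<partial>Y) = (\<integral>x. \<phi> (GY.tuple_at (m + 2) g (T x)) (w (T x)) \<partial>X)"
        by (rule T.integral_preimage[symmetric]) (rule borel_measurable_integrable[OF i\<phi>])
      also have "\<dots> = (\<integral>x. (\<Sum>i<m + 2. (-1) ^ i * \<beta> (GX.tuple_at ?n (?o i) x) (w (T x))) +
          \<psi> (GY.tuple_at (m + 2) g (T x)) (w (T x)) \<partial>X)"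
      proof (rule integral_cong_AE)
        show "(\<lambda>x. \<phi> (GY.tuple_at (m + 2) g (T x)) (w (T x))) \<in> borel_measurable X"
          by (rule borel_measurable_integrable[OF T.integrable_preimage[OF i\<phi>]])
        show "(\<lambda>x. (\<Sum>i<m + 2. (-1) ^ i * \<beta> (GX.tuple_at ?n (?o i) x) (w (T x))) +
          \<psi> (GY.tuple_at (m + 2) g (T x)) (w (T x))) \<in> borel_measurable X"
          by (intro borel_measurable_integrable Bochner_Integration.integrable_add Bochner_Integration.integrable_sum
              integrable_mult_right i\<beta> i\<psi>T)
        show "AE x in X. \<phi> (GY.tuple_at (m + 2) g (T x)) (w (T x)) =
            (\<Sum>i<m + 2. (-1) ^ i * \<beta> (GX.tuple_at ?n (?o i) x) (w (T x))) + \<psi> (GY.tuple_at (m + 2) g (T x)) (w (T x))"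
          using pe by eventually_elim (simp only: blinfun.add_left blinfun.sum_left blinfun.scaleR_left real_scaleR_def)
      qed
      also have "\<dots> = (\<Sum>i<m + 2. (-1) ^ i * (\<integral>x. \<beta> (GX.tuple_at ?n (?o i) x) (w (T x)) \<partial>X)) +
          (\<integral>x. \<psi> (GY.tuple_at (m + 2) g (T x)) (w (T x)) \<partial>X)"
        by (subst Bochner_Integration.integral_add, (intro Bochner_Integration.integrable_sum integrable_mult_right i\<beta> i\<psi>T)+,
            subst Bochner_Integration.integral_sum, (intro integrable_mult_right i\<beta>)+) (simp only: integral_mult_right_zero)
      also have "\<dots> = (\<Sum>i<m + 2. (-1) ^ i * (\<integral>y. F (?o i) y (w y) \<partial>Y)) + (\<integral>y. \<psi> (GY.tuple_at (m + 2) g y) (w y) \<partial>Y)"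
      proof -
        have "(\<integral>x. \<beta> (GX.tuple_at ?n (?o i) x) (w (T x)) \<partial>X) = (\<integral>y. F (?o i) y (w y) \<partial>Y)" for i
          using F(3)[OF o] w unfolding T.weakstar_cond_exp_def by blast
        then show ?thesis by (simp only: T.integral_preimage[OF borel_measurable_integrable[OF i\<psi>]])
      qed
      also have "\<dots> = (\<integral>y. S y (w y) \<partial>Y)"
        unfolding S_apply
        by (subst Bochner_Integration.integral_add, (intro Bochner_Integration.integrable_sum integrable_mult_right iF i\<psi>)+,
            subst Bochner_Integration.integral_sum, (intro integrable_mult_right iF)+) (simp only: integral_mult_right_zero)
      finally show "(\<integral>y. \<phi> (GY.tuple_at (m + 2) g y) (indicator A y *\<^sub>R v) \<partial>Y) = (\<integral>y. S y (indicator A y *\<^sub>R v) \<partial>Y)"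
        unfolding w_def .
    qed
    then show "AE y in Y. \<phi> (GY.tuple_at (m + 2) g y) =
        coboundary_function m b (GY.tuple_at (m + 2) g y) + \<psi> (GY.tuple_at (m + 2) g y)"
      using AE_space[of Y]
      by eventually_elim (simp only: GY.coboundary_function_tuple_at b[OF o] S_def)
  qed
  moreover have "b \<in> AY.Z m" using b_closed b_inv by (simp add: bounded_cochains_def)
  ultimately show thesis by (rule that[rotated])
qed

text \<open>Injectivity is tested on two classes and not on a kernel: equal images give a primitive
  on \<open>X\<close> for the difference of the pullbacks, and it descends to \<open>Y\<close>. That
  the map reaches the stated carrier follows because pullback commutes with the coboundary and
  respects null sets.\<close>

lemma Hmb_map_injective:
  "Hmb_map GX.G \<nu>G \<kappa>G (semidirect_map T) L (Suc m)
      \<in> carrier (Hmb GY.G \<nu>H \<kappa>H L (Suc m)) \<rightarrow> carrier (Hmb GX.G \<nu>G \<kappa>G (\<lambda>g. L (semidirect_map T g)) (Suc m))"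
  "inj_on (Hmb_map GX.G \<nu>G \<kappa>G (semidirect_map T) L (Suc m)) (carrier (Hmb GY.G \<nu>H \<kappa>H L (Suc m)))"
proof -
  let ?pb = "pullback_function (semidirect_map T)"
  have n: "0 < m + 2" "0 < m + 3" "Suc (Suc m) = m + 2" "Suc m + 1 = m + 2" "Suc m + 2 = m + 3" by simp_all
  have closed: "\<phi> \<in> carrier (bounded_weakstar_functions GY.G \<nu>H \<kappa>H (m + 2))" if "\<phi> \<in> AY.Z (Suc m)" for \<phi>
    using that unfolding bounded_cochains_def n(3) by blast
  show "Hmb_map GX.G \<nu>G \<kappa>G (semidirect_map T) L (Suc m)
      \<in> carrier (Hmb GY.G \<nu>H \<kappa>H L (Suc m)) \<rightarrow> carrier (Hmb GX.G \<nu>G \<kappa>G (\<lambda>g. L (semidirect_map T g)) (Suc m))"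
  proof
    fix c assume "c \<in> carrier (Hmb GY.G \<nu>H \<kappa>H L (Suc m))"
    then obtain \<phi> where \<phi>: "\<phi> \<in> AY.Z (Suc m)" "c = AY.coset m \<phi>"
        "AE p in tuple_measure GY.G \<nu>H \<kappa>H (m + 3). coboundary_function (Suc m) \<phi> p = 0"
      unfolding AY.carrier_Hmb_eq by blast
    have "?pb (m + 2) \<phi> \<in> AX.Z (Suc m)" using pullback_bounded_cochains[OF \<phi>(1)] unfolding n(3) .
    moreover have "AE p in tuple_measure GX.G \<nu>G \<kappa>G (m + 3). coboundary_function (Suc m) (?pb (m + 2) \<phi>) p = 0"
      using AE_pullback[OF n(2) \<phi>(3)] pullback_coboundary_function[of "semidirect_map T" "Suc m" \<phi>]
      unfolding n(4,5) by (simp add: pullback_function_def[of _ _ "\<lambda>_. 0"])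
    ultimately show "Hmb_map GX.G \<nu>G \<kappa>G (semidirect_map T) L (Suc m) c \<in>
        carrier (Hmb GX.G \<nu>G \<kappa>G (\<lambda>g. L (semidirect_map T g)) (Suc m))"
      unfolding \<phi>(2) Hmb_map_coset[OF closed[OF \<phi>(1)]] AX.carrier_Hmb_eq by blast
  qed
  show "inj_on (Hmb_map GX.G \<nu>G \<kappa>G (semidirect_map T) L (Suc m)) (carrier (Hmb GY.G \<nu>H \<kappa>H L (Suc m)))"
  proof (rule inj_onI)
    fix c d assume "c \<in> carrier (Hmb GY.G \<nu>H \<kappa>H L (Suc m))" "d \<in> carrier (Hmb GY.G \<nu>H \<kappa>H L (Suc m))"
      and eq: "Hmb_map GX.G \<nu>G \<kappa>G (semidirect_map T) L (Suc m) c = Hmb_map GX.G \<nu>G \<kappa>G (semidirect_map T) L (Suc m) d"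
    then obtain \<phi> \<psi> where \<phi>: "\<phi> \<in> AY.Z (Suc m)" "c = AY.coset m \<phi>" and \<psi>: "\<psi> \<in> AY.Z (Suc m)" "d = AY.coset m \<psi>"
      unfolding AY.carrier_Hmb_eq by blast
    note cl = closed[OF \<phi>(1)] closed[OF \<psi>(1)]
    have "AX.coset m (?pb (m + 2) \<phi>) = AX.coset m (?pb (m + 2) \<psi>)"
      using eq unfolding \<phi>(2) \<psi>(2) Hmb_map_coset[OF cl(1)] Hmb_map_coset[OF cl(2)] .
    then obtain \<beta> where \<beta>: "\<beta> \<in> AX.Z m" "AE p in tuple_measure GX.G \<nu>G \<kappa>G (m + 2).
        ?pb (m + 2) \<phi> p = coboundary_function m \<beta> p + ?pb (m + 2) \<psi> p"
      unfolding AX.coset_eq_iff[OF pullback_function_closed[OF n(1) cl(1)] pullback_function_closed[OF n(1) cl(2)]] by blast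
    from descend_primitive[OF \<beta>(1) cl \<beta>(2)]
    obtain b where "b \<in> AY.Z m" "AE p in tuple_measure GY.G \<nu>H \<kappa>H (m + 2). \<phi> p = coboundary_function m b p + \<psi> p" .
    then show "c = d" unfolding \<phi>(2) \<psi>(2) AY.coset_eq_iff[OF cl] by blast
  qed
qed

end

theorem proposition6p3:
  fixes \<Gamma> :: "'g monoid"
    and X :: "'x measure" and actX :: "'g \<Rightarrow> 'x \<Rightarrow> 'x"
    and Y :: "'y measure" and actY :: "'g \<Rightarrow> 'y \<Rightarrow> 'y"
    and T :: "'x \<Rightarrow> 'y"
    and \<G> :: "('g \<times> 'x, 'x) measured_groupoid"
    and \<nu>G :: "('g \<times> 'x) measure" and \<kappa>G :: "'x \<Rightarrow> ('g \<times> 'x) measure"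
    and \<H> :: "('g \<times> 'y, 'y) measured_groupoid"
    and \<nu>H :: "('g \<times> 'y) measure" and \<kappa>H :: "'y \<Rightarrow> ('g \<times> 'y) measure"
    and Lflat :: "'g \<times> 'y \<Rightarrow> 'b::{banach, second_countable_topology} \<Rightarrow>\<^sub>L 'b"
    and L :: "'g \<times> 'y \<Rightarrow> ('b \<Rightarrow>\<^sub>L real) \<Rightarrow> ('b \<Rightarrow>\<^sub>L real)"
  assumes "group \<Gamma>" and "countable (carrier \<Gamma>)"
    and "standard_probability_space X" and "pmp_action \<Gamma> X actX"
    and "standard_probability_space Y" and "pmp_action \<Gamma> Y actY"
    and "factor_map \<Gamma> X actX Y actY T"
    and "\<G> = semidirect \<Gamma> X actX" and "symmetric_class_measure \<G> \<nu>G \<kappa>G"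
    and "\<H> = semidirect \<Gamma> Y actY" and "symmetric_class_measure \<H> \<nu>H \<kappa>H"
    and "separable_hilbert_coefficient_module \<H> \<nu>H \<kappa>H Lflat"
    and "L = contragredient \<H> Lflat"
  shows "Hmb_map \<G> \<nu>G \<kappa>G (semidirect_map T) L 2
           \<in> carrier (Hmb \<H> \<nu>H \<kappa>H L 2)
             \<rightarrow> carrier (Hmb \<G> \<nu>G \<kappa>G (\<lambda>g. L (semidirect_map T g)) 2) \<and>
         inj_on (Hmb_map \<G> \<nu>G \<kappa>G (semidirect_map T) L 2) (carrier (Hmb \<H> \<nu>H \<kappa>H L 2))"
proof -
  interpret semidirect_factor \<Gamma> X actX \<nu>G \<kappa>G Y actY \<nu>H \<kappa>H T Lflat
    using assms
    by (simp add: semidirect_factor_def semidirect_groupoid_def semidirect_factor_axioms_def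
        separable_hilbert_coefficient_module_def)
  \<comment> \<open>Degree 2 is \<open>Suc m\<close> with \<open>m = 1\<close>, so the primitives
    that descend are functions of two arrows.\<close>
  show ?thesis
    using Hmb_map_injective[of 1] unfolding assms(8,10,13) numeral_2_eq_2 One_nat_def by blast
qed

end
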